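(* Let $\mathfrak{a}$ and $\mathfrak{b}$ be complex numbers with positive real and imaginary parts, and let $(\mathfrak{c},\mathfrak{d})=(\bar{\mathfrak{a}},\bar{\mathfrak{b}})$ or $(\mathfrak{c},\mathfrak{d})=(\bar{\mathfrak{b}},\bar{\mathfrak{a}})$. Let $\mathbf{B}_n(x)=\mathbf{B}_n(x;\mathfrak{a},\mathfrak{b},\mathfrak{c},\mathfrak{d})$ be the monic Bannai--Ito polynomials and set $\mathbf{Q}_n(z)=(-i)^n\,\mathbf{B}_n(iz;\mathfrak{a},\mathfrak{b},\mathfrak{c},\mathfrak{d})$. Then for all integers $n,m\ge 0$, $$\frac{1}{4\pi}\int_{-\infty}^{\infty}W(z)\,\mathbf{Q}_{n}(z)\,\mathbf{Q}_{m}(z)\,\mathrm{d}z=h_{0}\,\delta_{nm}\prod_{k=1}^{n}u_{k},$$ where the positive weight function $W$ is $$W(z)=\left|\frac{\Gamma(\mathfrak{a}+iz/2+1)\,\Gamma(\mathfrak{b}+iz/2+1)\,\Gamma(\mathfrak{c}+iz/2+1/2)\,\Gamma(\mathfrak{d}+iz/2+1/2)}{\Gamma(1/2+iz)}\right|^2,$$ the constant $h_0$ is $$h_{0}=\frac{\Gamma(\mathfrak{a}+\mathfrak{b}+3/2)\Gamma(\mathfrak{a}+\mathfrak{c}+1)\Gamma(\mathfrak{b}+\mathfrak{c}+1)\Gamma(\mathfrak{a}+\mathfrak{d}+1)\Gamma(\mathfrak{b}+\mathfrak{d}+1)\Gamma(\mathfrak{c}+\mathfrak{d}+3/2)}{\Gamma(\mathfrak{a}+\mathfrak{b}+\mathfrak{c}+\mathfrak{d}+2)},$$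 and $u_k=-A_{k-1}C_k$ with $A_k,C_k$ the recurrence coefficients of the Bannai--Ito polynomials.
   Context: The monic Bannai--Ito polynomials $\mathbf{B}_n(x)=\mathbf{B}_n(x;\mathfrak{a},\mathfrak{b},\mathfrak{c},\mathfrak{d})$ are defined by $\mathbf{B}_{-1}(x)=0$, $\mathbf{B}_0(x)=1$ and, for $n\ge 0$, $$x\mathbf{B}_{n}(x)=\mathbf{B}_{n+1}(x)+(2\mathfrak{a}+1-A_{n}-C_{n})\mathbf{B}_{n}(x)+A_{n-1}C_{n}\mathbf{B}_{n-1}(x),$$ where $$A_{n}=\begin{cases}\dfrac{(n+2\mathfrak{a}+2\mathfrak{c}+2)(n+2\mathfrak{a}+2\mathfrak{d}+2)}{2(n+\mathfrak{a}+\mathfrak{b}+\mathfrak{c}+\mathfrak{d}+2)} & n\text{ even}\\[2ex] \dfrac{(n+2\mathfrak{a}+2\mathfrak{b}+2)(n+2\mathfrak{a}+2\mathfrak{b}+2\mathfrak{c}+2\mathfrak{d}+3)}{2(n+\mathfrak{a}+\mathfrak{b}+\mathfrak{c}+\mathfrak{d}+2)} & n\text{ odd}\end{cases}$$ $$C_{n}=\begin{cases}-\dfrac{n(n+2\mathfrak{c}+2\mathfrak{d}+1)}{2(n+\mathfrak{a}+\mathfrak{b}+\mathfrak{c}+\mathfrak{d}+1)} & n\text{ even}\\[2ex] -\dfrac{(n+2\mathfrak{b}+2\mathfrak{c}+1)(n+2\mathfrak{b}+2\mathfrak{d}+1)}{2(n+\mathfrak{a}+\mathfrak{b}+\mathfrak{c}+\mathfrak{d}+1)}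 & n\text{ odd}\end{cases}$$ (In particular $C_0=0$.) Here $\Gamma$ is the Gamma function, $\delta_{nm}$ the Kronecker delta, $i^2=-1$, and bars denote complex conjugation. *)

theory Defs
  imports "HOL-Analysis.Analysis" "HOL-Computational_Algebra.Polynomial"
begin

definition BI_A :: "complex \<Rightarrow> complex \<Rightarrow> complex \<Rightarrow> complex \<Rightarrow> nat \<Rightarrow> complex" where
  "BI_A a b c d n =
     (if even n
      then (of_nat n + 2*a + 2*c + 2) * (of_nat n + 2*a + 2*d + 2)
             / (2 * (of_nat n + a + b + c + d + 2))
      else (of_nat n + 2*a + 2*b + 2) * (of_nat n + 2*a + 2*b + 2*c + 2*d + 3)
             / (2 * (of_nat n + a + b + c + d + 2)))"

definition BI_C :: "complex \<Rightarrow> complex \<Rightarrow> complex \<Rightarrow> complex \<Rightarrow> nat \<Rightarrow> complex" where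
  "BI_C a b c d n =
     (if even n
      then - (of_nat n * (of_nat n + 2*c + 2*d + 1)
             / (2 * (of_nat n + a + b + c + d + 1)))
      else - ((of_nat n + 2*b + 2*c + 1) * (of_nat n + 2*b + 2*d + 1)
             / (2 * (of_nat n + a + b + c + d + 1))))"

text \<open>
  The recurrence
  \<open>x B\<^sub>n(x) = B\<^sub>n\<^sub>+\<^sub>1(x) + (2a + 1 - A\<^sub>n - C\<^sub>n) B\<^sub>n(x) + A\<^sub>n\<^sub>-\<^sub>1 C\<^sub>n B\<^sub>n\<^sub>-\<^sub>1(x)\<close>
  solved for \<open>B\<^sub>n\<^sub>+\<^sub>1\<close>. The initial condition \<open>B\<^sub>-\<^sub>1 = 0\<close> is absorbed into the
  equation for index 1; \<open>[:- s, 1:]\<close> is the polynomial \<open>x - s\<close>.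
\<close>

fun bannai_ito :: "complex \<Rightarrow> complex \<Rightarrow> complex \<Rightarrow> complex \<Rightarrow> nat \<Rightarrow> complex poly" where
  "bannai_ito a b c d 0 = 1"
| "bannai_ito a b c d (Suc 0) =
     [:- (2*a + 1 - BI_A a b c d 0 - BI_C a b c d 0), 1:] * bannai_ito a b c d 0"
| "bannai_ito a b c d (Suc (Suc n)) =
     [:- (2*a + 1 - BI_A a b c d (Suc n) - BI_C a b c d (Suc n)), 1:] * bannai_ito a b c d (Suc n)
     - smult (BI_A a b c d n * BI_C a b c d (Suc n)) (bannai_ito a b c d n)"

definition BI_Q :: "complex \<Rightarrow> complex \<Rightarrow> complex \<Rightarrow> complex \<Rightarrow> nat \<Rightarrow> complex \<Rightarrow> complex" where
  "BI_Q a b c d n z = (- \<i>) ^ n * poly (bannai_ito a b c d n) (\<i> * z)"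

definition BI_W :: "complex \<Rightarrow> complex \<Rightarrow> complex \<Rightarrow> complex \<Rightarrow> real \<Rightarrow> real" where
  "BI_W a b c d z =
     (cmod (Gamma (a + \<i> * of_real z / 2 + 1) * Gamma (b + \<i> * of_real z / 2 + 1)
            * Gamma (c + \<i> * of_real z / 2 + 1/2) * Gamma (d + \<i> * of_real z / 2 + 1/2)
            / Gamma (1/2 + \<i> * of_real z)))\<^sup>2"

definition BI_h0 :: "complex \<Rightarrow> complex \<Rightarrow> complex \<Rightarrow> complex \<Rightarrow> complex" where
  "BI_h0 a b c d =
     Gamma (a + b + 3/2) * Gamma (a + c + 1) * Gamma (b + c + 1)
     * Gamma (a + d + 1) * Gamma (b + d + 1) * Gamma (c + d + 3/2)
     / Gamma (a + b + c + d + 2)"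

text \<open>Only used for indices \<open>k \<ge> 1\<close>, where the natural-number subtraction is exact.\<close>

definition BI_u :: "complex \<Rightarrow> complex \<Rightarrow> complex \<Rightarrow> complex \<Rightarrow> nat \<Rightarrow> complex" where
  "BI_u a b c d k = - BI_A a b c d (k - 1) * BI_C a b c d k"

end

(*
Put z = 2y and s = 1/4 + iy. Then x = iz = 2s - 1/2, and pi W(z) is the restriction to Re s = 1/4 of
  Gamma(p+s)Gamma(p-s) Gamma(q+s)Gamma(q-s) Gamma(r+s)Gamma(r+1-s) Gamma(t+s)Gamma(t+1-s) sin(2 pi s)
with p = a+3/4, q = b+3/4, r = c+1/4, t = d+1/4. Moving the line of integration to Re s = 0 turns the
zeroth moment into Wilson's integral. That integral is evaluated by a contiguous relation in p (moving
the line from Re s = 0 to Re s = 1/2, where the integrand is odd), the limit p -> infinity, which shows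
that its quotient by the expected Gamma factors does not depend on any parameter, and one special case.

For orthogonality let L_i(P) be the integral of P against the kernel with c replaced by c+i, and L'_i(P)
that of (c+i+1/4+s) P. Multiplication by x maps the pair (L_i, L'_i) to combinations of L_i, L'_i and
L_(i+1), and the values of L_i and L'_i on B_n have a closed form, a constant times a product
i(i-1)...(i-m+1) over a Pochhammer symbol, which the three-term recurrence propagates. At i = 0 it gives
L_0(B_n) = 0 for n >= 1, and Favard's argument concludes.
*)

theory Submission
  imports Defs "HOL-Complex_Analysis.Complex_Analysis" "HOL-Real_Asymp.Real_Asymp"
begin

text \<open>The shift to Re s = 0 meets no pole: with positive real parts of a, b, c, d the kernel
  is holomorphic for |Re s| <= 1/4. On that axis Gamma(r+1-s) = (r-s) Gamma(r-s), so the integrand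
  is an even Gamma product times an odd sine times a polynomial. Only the odd part of the polynomial
  contributes, and for the two moments that are needed it is a multiple of s, hence Wilson's weight.
  Since s sin(2 pi s) = - y sinh(2 pi y) at s = iy, Wilson's integral appears here with a minus
  sign. The statement L_0(B_n) = 0 does not propagate through the recurrence by itself: multiplying
  by x leads from L_0 to L'_0, from there to L_1, and so on. In effect polynomials are tested
  against 1, r+s, (r+s)(r+1-s), ..., where each new factor raises one Gamma argument by one, so that
  all these moments are Gamma products. The induction therefore carries explicit values for every i,
  and each of its steps is a rational identity in i, m and the parameters. The quantity S =
  a+b+c+d+2 is the argument of the Gamma function in the denominator of h_0; replacing c by c+i
  turns it into S+i.\<close>

section \<open>Exponential decay of the Gamma function on vertical strips\<close>

text \<open>Holds for each term of Euler's product. It bounds \<open>Gamma\<close> on a line by its values on a line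
  further right, hence reduces decay on strips to half-integer real parts.\<close>

lemma norm_Gamma_vertical_mono:
  fixes \<sigma> \<tau> y :: real
  assumes "0 < \<sigma>" "\<sigma> \<le> \<tau>"
  shows "norm (Gamma (Complex \<sigma> y)) * norm (Gamma (complex_of_real \<tau>))
       \<le> norm (Gamma (Complex \<tau> y)) * norm (Gamma (complex_of_real \<sigma>))"
proof -
  have factor: "norm (complex_of_real \<tau> + of_nat k) * norm (Complex \<sigma> y + of_nat k)
      \<ge> norm (complex_of_real \<sigma> + of_nat k) * norm (Complex \<tau> y + of_nat k)" for k :: nat
  proof -
    define u v where "u = \<sigma> + real k" and "v = \<tau> + real k"
    have uv: "0 < u" "u \<le> v" using assms by (auto simp: u_def v_def)
    have "(u * y)\<^sup>2 \<le> (v * y)\<^sup>2"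
      using uv by (simp add: power_mult_distrib mult_right_mono power_mono)
    hence "(u * sqrt (v\<^sup>2 + y\<^sup>2))\<^sup>2 \<le> (v * sqrt (u\<^sup>2 + y\<^sup>2))\<^sup>2"
      by (simp add: power_mult_distrib algebra_simps)
    hence "u * sqrt (v\<^sup>2 + y\<^sup>2) \<le> v * sqrt (u\<^sup>2 + y\<^sup>2)"
      using uv by (intro power2_le_imp_le[of "u * sqrt (v\<^sup>2 + y\<^sup>2)"]) auto
    moreover have "norm (complex_of_real \<sigma> + of_nat k) = u" "norm (complex_of_real \<tau> + of_nat k) = v"
      using uv unfolding u_def v_def by (simp_all add: cmod_def)
    ultimately show ?thesis
      by (simp add: cmod_def u_def v_def)
  qed
  have poch: "norm (pochhammer (complex_of_real \<sigma>) n) * norm (pochhammer (Complex \<tau> y) n)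
      \<le> norm (pochhammer (complex_of_real \<tau>) n) * norm (pochhammer (Complex \<sigma> y) n)" for n
    unfolding pochhammer_prod prod_norm[symmetric] prod.distrib[symmetric]
    by (intro prod_mono conjI factor) auto
  have series: "norm (Gamma_series (Complex \<sigma> y) n) * norm (Gamma_series (complex_of_real \<tau>) n)
      \<le> norm (Gamma_series (Complex \<tau> y) n) * norm (Gamma_series (complex_of_real \<sigma>) n)" for n
  proof -
    have nz: "norm (pochhammer z (Suc n)) > 0" if "Re z > 0" for z :: complex
    proof -
      have "z \<noteq> - of_nat k" for k
      proof
        assume "z = - of_nat k"
        hence "Re z = - real k" by simp
        thus False using that by simp
      qed
      thus ?thesis by (auto simp: pochhammer_eq_0_iff)
    qed
    have le: "inverse (norm (pochhammer (complex_of_real \<tau>) (Suc n)) * norm (pochhammer (Complex \<sigma> y) (Suc n)))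
      \<le> inverse (norm (pochhammer (complex_of_real \<sigma>) (Suc n)) * norm (pochhammer (Complex \<tau> y) (Suc n)))"
      using nz[of "complex_of_real \<sigma>"] nz[of "Complex \<tau> y"] assms poch[of "Suc n"]
      by (intro le_imp_inverse_le mult_pos_pos) auto
    \<comment> \<open>\<open>c\<close> collects the factorials and the moduli of the powers n^z; the
      latter depend only on real parts, so both sides share them.\<close>
    define c where "c = (fact n)\<^sup>2 * exp (\<sigma> * ln n) * exp (\<tau> * ln n)"
    have "c \<ge> 0" by (simp add: c_def)
    from mult_left_mono[OF le this] show ?thesis
      by (simp add: Gamma_series_def norm_mult norm_divide c_def divide_simps power2_eq_square mult_ac)
  qed
  show ?thesis
    by (rule LIMSEQ_le[OF tendsto_mult[OF tendsto_norm tendsto_norm] tendsto_mult[OF tendsto_norm tendsto_norm]])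
       (use series in \<open>auto intro!: Gamma_series_LIMSEQ\<close>)
qed

lemma cos_i_times: "cos (\<i> * complex_of_real t) = of_real (cosh t)"
  by (simp add: complex_eq_iff Re_cos Im_cos cosh_def)

lemma sin_i_times: "sin (\<i> * complex_of_real t) = \<i> * of_real (sinh t)"
  by (simp add: complex_eq_iff Re_sin Im_sin sinh_def)

text \<open>On Re z = 1/2 conjugation is z -> 1 - z, so the reflection formula gives |Gamma|^2 = pi
  / cosh(pi y) exactly. All decay on strips is derived from this line.\<close>

lemma norm_Gamma_half_le:
  "norm (Gamma (Complex (1/2) y)) \<le> sqrt (2 * pi) * exp (- (pi / 2) * \<bar>y\<bar>)"
proof -
  have eq1: "cnj (Complex (1/2) y) = 1 - Complex (1/2) y"
    by (simp add: complex_eq_iff)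
  have "complex_of_real ((norm (Gamma (Complex (1/2) y)))\<^sup>2)
      = Gamma (Complex (1/2) y) * Gamma (1 - Complex (1/2) y)"
    unfolding complex_norm_square using eq1 by (simp add: cnj_Gamma)
  also have "\<dots> = of_real pi / sin (of_real pi * Complex (1/2) y)"
    by (rule Gamma_reflection_complex)
  also have "of_real pi * Complex (1/2) y = of_real pi / 2 + \<i> * of_real (pi * y)"
    by (simp add: complex_eq_iff)
  also have "sin \<dots> = of_real (cosh (pi * y))"
    by (simp add: sin_add cos_i_times del: of_real_mult)
  finally have "complex_of_real ((norm (Gamma (Complex (1/2) y)))\<^sup>2) = of_real (pi / cosh (pi * y))"
    by simp
  hence *: "(norm (Gamma (Complex (1/2) y)))\<^sup>2 = pi / cosh (pi * y)"
    unfolding of_real_eq_iff .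
  have "cosh (pi * y) \<ge> exp (pi * \<bar>y\<bar>) / 2"
    by (cases "y \<ge> 0") (auto simp: cosh_def)
  hence "pi / cosh (pi * y) \<le> pi / (exp (pi * \<bar>y\<bar>) / 2)"
    by (intro divide_left_mono mult_pos_pos) auto
  also have "\<dots> = (sqrt (2 * pi) * exp (- (pi / 2) * \<bar>y\<bar>))\<^sup>2"
    by (simp add: power_mult_distrib exp_minus field_simps flip: exp_double)
  finally show ?thesis
    unfolding *[symmetric] by (rule power2_le_imp_le) auto
qed

text \<open>Each unit step to the right costs a factor |z|, which is paid for by giving up a little
  of the rate. Hence any rate below pi/2, and an induction that is general in
  \<open>\<theta>\<close>.\<close>

lemma norm_Gamma_half_int_le:
  assumes "\<theta> < pi / 2"
  shows "\<exists>C>0. \<forall>y. norm (Gamma (Complex (1/2 + real M) y)) \<le> C * exp (- \<theta> * \<bar>y\<bar>)"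
  using assms
proof (induction M arbitrary: \<theta>)
  case 0
  show ?case
  proof (intro exI[of _ "sqrt (2 * pi)"] conjI allI)
    fix y :: real
    have "exp (- (pi / 2) * \<bar>y\<bar>) \<le> exp (- \<theta> * \<bar>y\<bar>)"
      using 0 mult_right_mono[of \<theta> "pi / 2" "\<bar>y\<bar>"] by simp
    hence "sqrt (2 * pi) * exp (- (pi / 2) * \<bar>y\<bar>) \<le> sqrt (2 * pi) * exp (- \<theta> * \<bar>y\<bar>)"
      by (rule mult_left_mono) simp
    with norm_Gamma_half_le[of y]
    have "norm (Gamma (Complex (1/2) y)) \<le> sqrt (2 * pi) * exp (- \<theta> * \<bar>y\<bar>)"
      by (rule order_trans)
    thus "norm (Gamma (Complex (1/2 + real 0) y)) \<le> sqrt (2 * pi) * exp (- \<theta> * \<bar>y\<bar>)"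
      by simp
  qed auto
next
  case (Suc M)
  define \<eta> where "\<eta> = (\<theta> + pi / 2) / 2"
  have \<eta>: "\<theta> < \<eta>" "\<eta> < pi / 2" using Suc.prems by (auto simp: \<eta>_def)
  obtain C where C: "C > 0" "\<And>y. norm (Gamma (Complex (1/2 + real M) y)) \<le> C * exp (- \<eta> * \<bar>y\<bar>)"
    using Suc.IH[OF \<eta>(2)] by auto
  \<comment> \<open>The summand 1 / (eta - theta) makes the coefficient of |y| in D (1 + (eta -
    theta) |y|) at least 1.\<close>
  define D where "D = 1/2 + real M + 1 / (\<eta> - \<theta>)"
  have D: "D > 0" using \<eta> by (simp add: D_def add_nonneg_pos)
  show ?case
  proof (intro exI[of _ "D * C"] conjI allI)
    fix y :: real
    have "Complex (1/2 + real M) y \<notin> \<int>\<^sub>\<le>\<^sub>0" by (auto elim!: nonpos_Ints_cases simp: complex_eq_iff)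
    from Gamma_plus1[OF this] have "Gamma (Complex (1/2 + real (Suc M)) y)
        = Complex (1/2 + real M) y * Gamma (Complex (1/2 + real M) y)"
      by (simp add: complex_eq_iff Complex_eq add_ac)
    hence "norm (Gamma (Complex (1/2 + real (Suc M)) y))
        = norm (Complex (1/2 + real M) y) * norm (Gamma (Complex (1/2 + real M) y))"
      by (simp add: norm_mult)
    also have "\<dots> \<le> (D * exp ((\<eta> - \<theta>) * \<bar>y\<bar>)) * (C * exp (- \<eta> * \<bar>y\<bar>))"
    proof (intro mult_mono C)
      have "norm (Complex (1/2 + real M) y) \<le> 1/2 + real M + \<bar>y\<bar>"
        using cmod_le[of "Complex (1/2 + real M) y"] by simp
      also have "\<dots> \<le> D * (1 + (\<eta> - \<theta>) * \<bar>y\<bar>)"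
      proof -
        have "D * (1 + (\<eta> - \<theta>) * \<bar>y\<bar>) = 1/2 + real M + \<bar>y\<bar> + 1 / (\<eta> - \<theta>) + (1/2 + real M) * (\<eta> - \<theta>) * \<bar>y\<bar>"
          using \<eta> by (simp add: D_def field_simps)
        thus ?thesis using \<eta> by simp
      qed
      also have "\<dots> \<le> D * exp ((\<eta> - \<theta>) * \<bar>y\<bar>)"
        using D by (intro mult_left_mono exp_ge_add_one_self) auto
      finally show "norm (Complex (1/2 + real M) y) \<le> D * exp ((\<eta> - \<theta>) * \<bar>y\<bar>)" .
    qed (use D in auto)
    also have "\<dots> = D * C * (exp ((\<eta> - \<theta>) * \<bar>y\<bar>) * exp (- \<eta> * \<bar>y\<bar>))"
      by simp
    also have "exp ((\<eta> - \<theta>) * \<bar>y\<bar>) * exp (- \<eta> * \<bar>y\<bar>) = exp (- \<theta> * \<bar>y\<bar>)"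
      by (simp add: exp_add[symmetric] algebra_simps)
    finally show "norm (Gamma (Complex (1/2 + real (Suc M)) y)) \<le> D * C * exp (- \<theta> * \<bar>y\<bar>)" .
  qed (use C D in auto)
qed

lemma norm_Gamma_strip_le:
  assumes "0 < \<alpha>" "\<theta> < pi / 2"
  obtains C where "C > 0"
    "\<And>z. \<alpha> \<le> Re z \<Longrightarrow> Re z \<le> \<beta> \<Longrightarrow> norm (Gamma z) \<le> C * exp (- \<theta> * \<bar>Im z\<bar>)"
proof -
  obtain M :: nat where M: "\<beta> \<le> real M" using real_arch_simple by blast
  define \<tau> where "\<tau> = 1/2 + real M"
  have \<tau>: "\<tau> > 0" "\<beta> \<le> \<tau>" using M by (auto simp: \<tau>_def)
  obtain C where C: "C > 0" "\<And>y. norm (Gamma (Complex \<tau> y)) \<le> C * exp (- \<theta> * \<bar>y\<bar>)"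
    using norm_Gamma_half_int_le[OF assms(2), of M] unfolding \<tau>_def by auto
  have "compact ((\<lambda>x. norm (Gamma (complex_of_real x))) ` {\<alpha>..\<beta>})"
    using assms
    by (intro compact_continuous_image continuous_on_norm
          continuous_on_compose2[OF continuous_on_Gamma[of "{z. Re z > 0}"], of _ complex_of_real]
          continuous_on_of_real continuous_on_id compact_Icc) (auto elim!: nonpos_Ints_cases)
  hence "bounded ((\<lambda>x. norm (Gamma (complex_of_real x))) ` {\<alpha>..\<beta>})" by (rule compact_imp_bounded)
  then obtain B where B: "B > 0" "\<And>x. x \<in> {\<alpha>..\<beta>} \<Longrightarrow> norm (Gamma (complex_of_real x)) \<le> B"
    unfolding bounded_pos by auto
  define G where "G = norm (Gamma (complex_of_real \<tau>))"
  have G: "G > 0" using \<tau> by (simp add: G_def Gamma_complex_of_real Gamma_eq_zero_iff)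
  show ?thesis
  proof (rule that[of "C * B / G"])
    show "C * B / G > 0" using B C G by simp
    fix z assume z: "\<alpha> \<le> Re z" "Re z \<le> \<beta>"
    have "norm (Gamma z) * G \<le> norm (Gamma (Complex \<tau> (Im z))) * norm (Gamma (complex_of_real (Re z)))"
      using norm_Gamma_vertical_mono[of "Re z" \<tau> "Im z"] z \<tau> assms by (simp add: G_def)
    also have "\<dots> \<le> (C * exp (- \<theta> * \<bar>Im z\<bar>)) * B"
      using z B C by (intro mult_mono C B) auto
    finally show "norm (Gamma z) \<le> C * B / G * exp (- \<theta> * \<bar>Im z\<bar>)"
      using G by (simp add: field_simps)
  qed
qed

section \<open>Shifting the line of integration\<close>

definition strip :: "real \<Rightarrow> real \<Rightarrow> complex set" where
  "strip \<alpha> \<beta> = {s. \<alpha> < Re s \<and> Re s < \<beta>}"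

lemma open_strip [simp]: "open (strip \<alpha> \<beta>)"
  unfolding strip_def by (intro open_Collect_conj open_halfspace_Re_gt open_halfspace_Re_lt)

lemma convex_strip [simp]: "convex (strip \<alpha> \<beta>)"
proof -
  have "strip \<alpha> \<beta> = {s. Re s > \<alpha>} \<inter> {s. Re s < \<beta>}" by (auto simp: strip_def)
  thus ?thesis by (simp add: convex_Int convex_halfspace_Re_gt convex_halfspace_Re_lt)
qed

definition strip_decay :: "real \<Rightarrow> real \<Rightarrow> real \<Rightarrow> (complex \<Rightarrow> complex) \<Rightarrow> bool" where
  "strip_decay \<alpha> \<beta> r f \<longleftrightarrow> f holomorphic_on strip \<alpha> \<beta> \<and>
     (\<exists>C\<ge>0. \<forall>s\<in>strip \<alpha> \<beta>. norm (f s) \<le> C * exp (- r * \<bar>Im s\<bar>))"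

lemma strip_decayI:
  assumes "f holomorphic_on strip \<alpha> \<beta>"
    "\<And>s. s \<in> strip \<alpha> \<beta> \<Longrightarrow> norm (f s) \<le> C * exp (- r * \<bar>Im s\<bar>)"
  shows "strip_decay \<alpha> \<beta> r f"
proof -
  have "norm (f s) \<le> max 0 C * exp (- r * \<bar>Im s\<bar>)" if "s \<in> strip \<alpha> \<beta>" for s
    by (rule order_trans[OF assms(2)[OF that]]) (intro mult_right_mono, auto)
  thus ?thesis unfolding strip_decay_def using assms(1) by (auto intro!: exI[of _ "max 0 C"])
qed

lemma strip_decayE:
  assumes "strip_decay \<alpha> \<beta> r f"
  obtains C where "C \<ge> 0" "f holomorphic_on strip \<alpha> \<beta>"
    "\<And>s. s \<in> strip \<alpha> \<beta> \<Longrightarrow> norm (f s) \<le> C * exp (- r * \<bar>Im s\<bar>)"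
  using assms unfolding strip_decay_def by blast

lemma strip_decay_mult:
  assumes "strip_decay \<alpha> \<beta> r f" "strip_decay \<alpha> \<beta> r' g"
  shows "strip_decay \<alpha> \<beta> (r + r') (\<lambda>s. f s * g s)"
proof -
  obtain C where C: "C \<ge> 0" "f holomorphic_on strip \<alpha> \<beta>"
    "\<And>s. s \<in> strip \<alpha> \<beta> \<Longrightarrow> norm (f s) \<le> C * exp (- r * \<bar>Im s\<bar>)"
    using strip_decayE[OF assms(1)] by blast
  obtain D where D: "D \<ge> 0" "g holomorphic_on strip \<alpha> \<beta>"
    "\<And>s. s \<in> strip \<alpha> \<beta> \<Longrightarrow> norm (g s) \<le> D * exp (- r' * \<bar>Im s\<bar>)"
    using strip_decayE[OF assms(2)] by blast
  show ?thesis
  proof (rule strip_decayI[where C = "C * D"])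
    fix s assume s: "s \<in> strip \<alpha> \<beta>"
    have "norm (f s * g s) \<le> (C * exp (- r * \<bar>Im s\<bar>)) * (D * exp (- r' * \<bar>Im s\<bar>))"
      unfolding norm_mult using C D s by (intro mult_mono) auto
    also have "\<dots> = C * D * exp (- (r + r') * \<bar>Im s\<bar>)"
      by (simp add: exp_add[symmetric] algebra_simps)
    finally show "norm (f s * g s) \<le> C * D * exp (- (r + r') * \<bar>Im s\<bar>)" .
  qed (intro holomorphic_intros C D)
qed

lemma strip_decay_mono:
  assumes "strip_decay \<alpha> \<beta> r f" "r' \<le> r"
  shows "strip_decay \<alpha> \<beta> r' f"
proof -
  obtain C where C: "C \<ge> 0" "f holomorphic_on strip \<alpha> \<beta>"
    "\<And>s. s \<in> strip \<alpha> \<beta> \<Longrightarrow> norm (f s) \<le> C * exp (- r * \<bar>Im s\<bar>)"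
    using strip_decayE[OF assms(1)] by blast
  show ?thesis
  proof (rule strip_decayI[where C = C])
    fix s assume s: "s \<in> strip \<alpha> \<beta>"
    have "C * exp (- r * \<bar>Im s\<bar>) \<le> C * exp (- r' * \<bar>Im s\<bar>)"
      using C assms(2) by (intro mult_left_mono) (auto intro!: mult_right_mono)
    with C(3)[OF s] show "norm (f s) \<le> C * exp (- r' * \<bar>Im s\<bar>)" by (rule order_trans)
  qed (rule C)
qed

lemma strip_decay_add:
  assumes "strip_decay \<alpha> \<beta> r f" "strip_decay \<alpha> \<beta> r g"
  shows "strip_decay \<alpha> \<beta> r (\<lambda>s. f s + g s)"
proof -
  obtain C where C: "C \<ge> 0" "f holomorphic_on strip \<alpha> \<beta>"
    "\<And>s. s \<in> strip \<alpha> \<beta> \<Longrightarrow> norm (f s) \<le> C * exp (- r * \<bar>Im s\<bar>)"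
    using strip_decayE[OF assms(1)] by blast
  obtain D where D: "D \<ge> 0" "g holomorphic_on strip \<alpha> \<beta>"
    "\<And>s. s \<in> strip \<alpha> \<beta> \<Longrightarrow> norm (g s) \<le> D * exp (- r * \<bar>Im s\<bar>)"
    using strip_decayE[OF assms(2)] by blast
  show ?thesis
  proof (rule strip_decayI[where C = "C + D"])
    fix s assume s: "s \<in> strip \<alpha> \<beta>"
    show "norm (f s + g s) \<le> (C + D) * exp (- r * \<bar>Im s\<bar>)"
      using norm_triangle_mono[OF C(3)[OF s] D(3)[OF s]] by (simp add: distrib_right)
  qed (intro holomorphic_intros C D)
qed

lemma strip_decay_const: "r \<le> 0 \<Longrightarrow> strip_decay \<alpha> \<beta> r (\<lambda>s. c)"
proof (rule strip_decayI[where C = "norm c"])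
  fix s :: complex assume "r \<le> 0"
  hence "exp (- r * \<bar>Im s\<bar>) \<ge> 1" by (simp add: mult_nonpos_nonneg)
  thus "norm c \<le> norm c * exp (- r * \<bar>Im s\<bar>)"
    using mult_left_mono[of 1 "exp (- r * \<bar>Im s\<bar>)" "norm c"] by simp
qed auto

lemma strip_decay_ident:
  assumes "r < 0"
  shows "strip_decay \<alpha> \<beta> r (\<lambda>s. s)"
proof (rule strip_decayI[where C = "\<bar>\<alpha>\<bar> + \<bar>\<beta>\<bar> + 1 / (- r)"])
  fix s assume s: "s \<in> strip \<alpha> \<beta>"
  define D where "D = \<bar>\<alpha>\<bar> + \<bar>\<beta>\<bar>"
  have D: "D \<ge> 0" by (simp add: D_def)
  have "norm s \<le> D + \<bar>Im s\<bar>"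
    using cmod_le[of s] s by (auto simp: strip_def D_def)
  also have "\<dots> \<le> (D + 1 / (- r)) * (1 + (- r) * \<bar>Im s\<bar>)"
  proof -
    have "(D + 1 / (- r)) * (1 + (- r) * \<bar>Im s\<bar>) = D + \<bar>Im s\<bar> + 1 / (- r) + D * (- r) * \<bar>Im s\<bar>"
      using assms by (simp add: field_simps)
    moreover have "1 / (- r) \<ge> 0" "D * (- r) * \<bar>Im s\<bar> \<ge> 0"
      using assms D by (intro divide_nonneg_nonneg mult_nonneg_nonneg; simp)+
    ultimately show ?thesis by linarith
  qed
  also have "\<dots> \<le> (D + 1 / (- r)) * exp (- r * \<bar>Im s\<bar>)"
    using assms D by (intro mult_left_mono exp_ge_add_one_self add_nonneg_nonneg divide_nonneg_nonneg) auto
  finally show "norm s \<le> (\<bar>\<alpha>\<bar> + \<bar>\<beta>\<bar> + 1 / (- r)) * exp (- r * \<bar>Im s\<bar>)" by (simp add: D_def)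
qed auto

text \<open>Any loss of rate, however small, absorbs polynomial growth. Horner's step spends half of
  it on the factor \<open>s\<close> and half on the rest, so the induction is general in
  \<open>r\<close>.\<close>

lemma strip_decay_poly:
  assumes "r < 0"
  shows "strip_decay \<alpha> \<beta> r (poly P)"
  using assms
proof (induction P arbitrary: r)
  case (pCons c P)
  have "strip_decay \<alpha> \<beta> (r/2 + r/2) (\<lambda>s. s * poly P s)"
    using pCons by (intro strip_decay_mult strip_decay_ident) auto
  thus ?case using pCons.prems
    by (auto intro!: strip_decay_add strip_decay_const)
qed (simp add: strip_decay_const poly_0[abs_def])

lemma strip_decay_Gamma_plus:
  assumes "Re p + \<alpha> > 0" "\<theta> < pi / 2" "\<theta> \<ge> 0"
  shows "strip_decay \<alpha> \<beta> \<theta> (\<lambda>s. Gamma (p + s))"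
proof -
  obtain C where C: "C > 0" "\<And>z. Re p + \<alpha> \<le> Re z \<Longrightarrow> Re z \<le> Re p + \<beta> \<Longrightarrow>
      norm (Gamma z) \<le> C * exp (- \<theta> * \<bar>Im z\<bar>)"
    using norm_Gamma_strip_le[OF assms(1,2), of "Re p + \<beta>"] by blast
  show ?thesis
  \<comment> \<open>The extra exponential accounts for measuring decay by Im s instead of Im (p +
    s).\<close>
  proof (rule strip_decayI[where C = "C * exp (\<theta> * \<bar>Im p\<bar>)"])
    show "(\<lambda>s. Gamma (p + s)) holomorphic_on strip \<alpha> \<beta>"
      using assms by (intro holomorphic_intros) (auto simp: strip_def elim!: nonpos_Ints_cases dest!: arg_cong[where f = Re])
    fix s assume s: "s \<in> strip \<alpha> \<beta>"
    have "norm (Gamma (p + s)) \<le> C * exp (- \<theta> * \<bar>Im (p + s)\<bar>)"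
      using s by (intro C) (auto simp: strip_def)
    also have "\<dots> \<le> C * exp (\<theta> * \<bar>Im p\<bar> + - \<theta> * \<bar>Im s\<bar>)"
    proof -
      have "\<theta> * \<bar>Im s\<bar> \<le> \<theta> * (\<bar>Im p\<bar> + \<bar>Im (p + s)\<bar>)"
        using assms(3) by (intro mult_left_mono) auto
      thus ?thesis using C(1) by (auto simp: algebra_simps)
    qed
    finally show "norm (Gamma (p + s)) \<le> C * exp (\<theta> * \<bar>Im p\<bar>) * exp (- \<theta> * \<bar>Im s\<bar>)"
      by (simp only: exp_add mult.assoc)
  qed
qed

lemma strip_decay_uminus:
  assumes "strip_decay (-\<beta>) (-\<alpha>) r f"
  shows "strip_decay \<alpha> \<beta> r (\<lambda>s. f (- s))"
proof -
  obtain C where C: "C \<ge> 0" "f holomorphic_on strip (-\<beta>) (-\<alpha>)"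
    "\<And>s. s \<in> strip (-\<beta>) (-\<alpha>) \<Longrightarrow> norm (f s) \<le> C * exp (- r * \<bar>Im s\<bar>)"
    using strip_decayE[OF assms(1)] by blast
  have img: "-s \<in> strip (-\<beta>) (-\<alpha>)" if "s \<in> strip \<alpha> \<beta>" for s
    using that by (auto simp: strip_def)
  show ?thesis
  proof (rule strip_decayI[where C = C])
    have "f \<circ> uminus holomorphic_on strip \<alpha> \<beta>"
      by (rule holomorphic_on_compose_gen[OF _ C(2)]) (auto intro!: holomorphic_intros img)
    thus "(\<lambda>s. f (- s)) holomorphic_on strip \<alpha> \<beta>" by (simp add: o_def)
  qed (use C(3)[OF img] in auto)
qed

lemma strip_decay_Gamma_minus:
  assumes "Re p > \<beta>" "\<theta> < pi / 2" "\<theta> \<ge> 0"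
  shows "strip_decay \<alpha> \<beta> \<theta> (\<lambda>s. Gamma (p - s))"
  using strip_decay_uminus[OF strip_decay_Gamma_plus[of p "-\<beta>" \<theta> "-\<alpha>"]] assms by simp

lemma strip_decay_sin: "strip_decay \<alpha> \<beta> (- (2 * pi)) (\<lambda>s. sin (2 * of_real pi * s))"
proof (rule strip_decayI[where C = 1])
  fix s :: complex
  let ?t = "2 * of_real pi * s"
  have "norm (exp (\<i> * ?t) - exp (- (\<i> * ?t))) \<le> norm (exp (\<i> * ?t)) + norm (exp (- (\<i> * ?t)))"
    by (rule norm_triangle_ineq4)
  also have "\<dots> \<le> exp (2 * pi * \<bar>Im s\<bar>) + exp (2 * pi * \<bar>Im s\<bar>)"
    using abs_ge_self[of "pi * Im s"] abs_ge_minus_self[of "pi * Im s"]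
    by (intro add_mono) (auto simp: abs_mult)
  finally show "norm (sin ?t) \<le> 1 * exp (- (- (2 * pi)) * \<bar>Im s\<bar>)"
    by (simp add: sin_exp_eq norm_divide norm_mult)
qed (intro holomorphic_intros)

section \<open>Integrability on vertical lines and the shift between them\<close>

lemma has_bochner_integral_sech:
  assumes "r > 0"
  shows "has_bochner_integral lborel (\<lambda>y::real. 1 / cosh (r * y)) (pi / r)"
proof -
  \<comment> \<open>The Gudermannian antiderivative. The exact value pi / r is used in
    \<open>integral_square_sech\<close>; integrability alone dominates exp(-r|y|).\<close>
  define F where "F = (\<lambda>y. 2 / r * arctan (exp (r * y)))"
  have deriv: "(F has_real_derivative 1 / cosh (r * y)) (at y)" for y
  proof -
    have "(F has_real_derivative 2 / r * (inverse (1 + (exp (r * y))\<^sup>2) * (exp (r * y) * r))) (at y)"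
      unfolding F_def by (auto intro!: derivative_eq_intros)
    also have "2 / r * (inverse (1 + (exp (r * y))\<^sup>2) * (exp (r * y) * r)) = 2 * exp (r * y) / (1 + (exp (r * y))\<^sup>2)"
      using assms by (simp add: divide_inverse)
    also have "\<dots> = 1 / cosh (r * y)"
      by (simp add: cosh_def exp_minus power2_eq_square divide_simps)
    finally show ?thesis .
  qed
  have lim: "((F \<circ> real_of_ereal) \<longlongrightarrow> 0) (at_right (-\<infinity>))" "((F \<circ> real_of_ereal) \<longlongrightarrow> pi / r) (at_left \<infinity>)"
  proof -
    have "(F \<longlongrightarrow> 2 / r * arctan 0) at_bot" unfolding F_def
    proof (intro tendsto_intros)
      show "((\<lambda>y. exp (r * y)) \<longlongrightarrow> 0) at_bot" using assms by real_asymp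
    qed
    thus "((F \<circ> real_of_ereal) \<longlongrightarrow> 0) (at_right (-\<infinity>))"
      by (simp add: ereal_tendsto_simps)
    have "(F \<longlongrightarrow> 2 / r * (pi / 2)) at_top" unfolding F_def
    proof (intro tendsto_intros filterlim_compose[OF tendsto_arctan_at_top])
      show "filterlim (\<lambda>y. exp (r * y)) at_top at_top" using assms by real_asymp
    qed
    thus "((F \<circ> real_of_ereal) \<longlongrightarrow> pi / r) (at_left \<infinity>)"
      by (simp add: ereal_tendsto_simps)
  qed
  note FTC = interval_integral_FTC_nonneg[of "-\<infinity>" "\<infinity>" F "\<lambda>y. 1 / cosh (r * y)" 0 "pi / r", OF _ _ _ _ lim]
  have "set_integrable lborel (einterval (-\<infinity>) \<infinity>) (\<lambda>y. 1 / cosh (r * y))"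
    by (rule FTC(1)) (auto intro!: deriv continuous_intros)
  moreover have "(LBINT y=-\<infinity>..\<infinity>. 1 / cosh (r * y)) = pi / r - 0"
    by (rule FTC(2)) (auto intro!: deriv continuous_intros)
  ultimately show ?thesis
    by (simp add: has_bochner_integral_iff set_integrable_def
        interval_lebesgue_integral_def set_lebesgue_integral_def)
qed

lemma integrable_exp_neg_abs:
  assumes "r > 0"
  shows "integrable lborel (\<lambda>y::real. exp (- r * \<bar>y\<bar>))"
proof (rule Bochner_Integration.integrable_bound)
  show "integrable lborel (\<lambda>y::real. 1 / cosh (r * y))"
    using has_bochner_integral_sech[OF assms] by (simp add: has_bochner_integral_iff)
  show "AE y in lborel. norm (exp (- r * \<bar>y\<bar>)) \<le> norm (1 / cosh (r * y))"
  proof (rule AE_I2)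
    fix y :: real
    have "r * y \<le> r * \<bar>y\<bar>" "- (r * y) \<le> r * \<bar>y\<bar>"
      using assms abs_ge_self[of "r * y"] abs_ge_minus_self[of "r * y"] by (auto simp: abs_mult)
    hence "exp (r * y) \<le> exp (r * \<bar>y\<bar>)" "exp (- (r * y)) \<le> exp (r * \<bar>y\<bar>)" by simp_all
    from add_mono[OF this] have "cosh (r * y) \<le> exp (r * \<bar>y\<bar>)" by (simp add: cosh_def)
    thus "norm (exp (- r * \<bar>y\<bar>)) \<le> norm (1 / cosh (r * y))"
      by (simp add: exp_minus field_simps)
  qed
qed auto

lemma strip_decay_measurable:
  assumes "strip_decay \<alpha> \<beta> r f" "\<alpha> < x" "x < \<beta>"
  shows "continuous_on A (\<lambda>y. f (Complex x y))" "(\<lambda>y. f (Complex x y)) \<in> borel_measurable borel"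
proof -
  have "continuous_on UNIV (\<lambda>y. f (Complex x y))"
    using assms holomorphic_on_imp_continuous_on
    by (intro continuous_on_compose2[of "strip \<alpha> \<beta>" f UNIV "Complex x"])
       (auto simp: strip_decay_def strip_def Complex_eq intro!: continuous_intros)
  thus "(\<lambda>y. f (Complex x y)) \<in> borel_measurable borel" "continuous_on A (\<lambda>y. f (Complex x y))"
    by (auto intro: borel_measurable_continuous_onI continuous_on_subset)
qed

lemma strip_decay_integrable:
  assumes "strip_decay \<alpha> \<beta> r f" "\<alpha> < x" "x < \<beta>" "r > 0"
  shows "integrable lborel (\<lambda>y. f (Complex x y))"
proof -
  obtain C where C: "C \<ge> 0"
    "\<And>s. s \<in> strip \<alpha> \<beta> \<Longrightarrow> norm (f s) \<le> C * exp (- r * \<bar>Im s\<bar>)"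
    using strip_decayE[OF assms(1)] by blast
  show ?thesis
  proof (rule Bochner_Integration.integrable_bound)
    show "integrable lborel (\<lambda>y. C * exp (- r * \<bar>y\<bar>))"
      using integrable_exp_neg_abs[OF assms(4)] by simp
    show "AE y in lborel. norm (f (Complex x y)) \<le> norm (C * exp (- r * \<bar>y\<bar>))"
      using C(2)[of "Complex x _"] assms C(1) by (auto simp: strip_def)
  qed (use strip_decay_measurable[OF assms(1-3)] in auto)
qed

text \<open>A primitive \<open>F\<close> on the convex strip replaces the rectangular contour:
  truncated integrals are differences of values of \<open>F\<close>, and two lines differ only by
  the increments of \<open>F\<close> along the horizontal edges at heights n and -n, which tend to
  zero.\<close>

lemma strip_decay_shift:
  assumes f: "strip_decay \<alpha> \<beta> r f" and "r > 0" and x: "\<alpha> < x" "x < \<beta>" and x': "\<alpha> < x'" "x' < \<beta>"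
  shows "(LINT y|lborel. f (Complex x y)) = (LINT y|lborel. f (Complex x' y))"
proof -
  obtain C where C: "C \<ge> 0" "f holomorphic_on strip \<alpha> \<beta>"
    "\<And>s. s \<in> strip \<alpha> \<beta> \<Longrightarrow> norm (f s) \<le> C * exp (- r * \<bar>Im s\<bar>)"
    using strip_decayE[OF f] by blast
  obtain F where F: "\<And>s. s \<in> strip \<alpha> \<beta> \<Longrightarrow> (F has_field_derivative f s) (at s)"
    using holomorphic_convex_primitive'[OF convex_strip open_strip C(2)] by (metis at_within_open open_strip)
  have trunc: "(LBINT y. indicator {- real n..real n} y *\<^sub>R f (Complex u y))
      = (F (Complex u (real n)) - F (Complex u (- real n))) / \<i>" if u: "\<alpha> < u" "u < \<beta>" for u n
  proof -
    have "(LBINT y. indicator {- real n..real n} y *\<^sub>R f (Complex u y))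
        = F (Complex u (real n)) / \<i> - F (Complex u (- real n)) / \<i>"
    proof (rule integral_FTC_Icc)
      fix y :: real
      have "Complex u y \<in> strip \<alpha> \<beta>" using u by (simp add: strip_def)
      note F' = F[OF this]
      have "(Complex u has_vector_derivative \<i>) (at y)"
        unfolding Complex_eq[abs_def]
        by (auto intro!: derivative_eq_intros has_vector_derivative_real_field)
      from field_vector_diff_chain_at[of "Complex u" \<i> y F, OF this F']
      have "(F \<circ> Complex u has_vector_derivative \<i> * f (Complex u y)) (at y)" .
      from has_vector_derivative_mult_right[OF this, of "1 / \<i>"]
      show "((\<lambda>y. F (Complex u y) / \<i>) has_vector_derivative f (Complex u y)) (at y within {- real n..real n})"
        by (simp add: o_def has_vector_derivative_at_within)
    qed (use strip_decay_measurable[OF f u] in auto)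
    thus ?thesis unfolding diff_divide_distrib .
  qed
  have lim: "(\<lambda>n. (F (Complex u (real n)) - F (Complex u (- (real n)))) / \<i>) \<longlonglongrightarrow> (LINT y|lborel. f (Complex u y))"
    if u: "\<alpha> < u" "u < \<beta>" for u
  proof -
    have "(\<lambda>n. LBINT y. indicator {- real n..real n} y *\<^sub>R f (Complex u y)) \<longlonglongrightarrow> (LINT y|lborel. f (Complex u y))"
    proof (rule integral_dominated_convergence[where w = "\<lambda>y. norm (f (Complex u y))"])
      show "integrable lborel (\<lambda>y. norm (f (Complex u y)))"
        using strip_decay_integrable[OF f u \<open>r > 0\<close>] by (rule integrable_norm)
      show "AE y in lborel. (\<lambda>n. indicator {- real n..real n} y *\<^sub>R f (Complex u y)) \<longlonglongrightarrow> f (Complex u y)"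
      proof (rule AE_I2, rule tendsto_eventually)
        fix y :: real
        obtain N :: nat where "\<bar>y\<bar> \<le> real N" using real_arch_simple by blast
        thus "\<forall>\<^sub>F n in sequentially. indicator {- real n..real n} y *\<^sub>R f (Complex u y) = f (Complex u y)"
          by (intro eventually_sequentiallyI[of N]) (auto simp: indicator_def)
      qed
    qed (use strip_decay_measurable[OF f u] in \<open>auto simp: indicator_def\<close>)
    thus ?thesis unfolding trunc[OF u] .
  qed
  \<comment> \<open>The mean value inequality along a horizontal edge, where the derivative
    \<open>f\<close> of \<open>F\<close> is bounded by the decay at height \<open>t\<close>.\<close>
  have edge: "norm (F (Complex x t) - F (Complex x' t)) \<le> C * exp (- r * \<bar>t\<bar>) * \<bar>x - x'\<bar>" for t
  proof -
    let ?S = "{s \<in> strip \<alpha> \<beta>. Im s = t}"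
    have "norm (F (Complex x t) - F (Complex x' t)) \<le> C * exp (- r * \<bar>t\<bar>) * norm (Complex x t - Complex x' t)"
    proof (rule field_differentiable_bound[where S = ?S and f' = f])
      have "?S = strip \<alpha> \<beta> \<inter> {s. Im s = t}" by auto
      moreover have "convex {s. Im s = t}"
        by (rule convexI) (simp flip: distrib_right)
      ultimately show "convex ?S" by (simp add: convex_Int)
    qed (use x x' C(3) F in \<open>auto simp: strip_def intro: has_field_derivative_at_within\<close>)
    also have "norm (Complex x t - Complex x' t) = \<bar>x - x'\<bar>" by (simp add: cmod_def)
    finally show ?thesis .
  qed
  have "(\<lambda>n. (F (Complex x (real n)) - F (Complex x' (real n))) / \<i> -
             (F (Complex x (- (real n))) - F (Complex x' (- (real n)))) / \<i>) \<longlonglongrightarrow> 0"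
  proof (rule Lim_null_comparison)
    show "\<forall>\<^sub>F n in sequentially. norm ((F (Complex x (real n)) - F (Complex x' (real n))) / \<i> -
             (F (Complex x (- (real n))) - F (Complex x' (- (real n)))) / \<i>) \<le> 2 * (C * exp (- r * real n) * \<bar>x - x'\<bar>)"
    proof (rule always_eventually, rule allI)
      fix n
      show "norm ((F (Complex x (real n)) - F (Complex x' (real n))) / \<i> -
             (F (Complex x (- (real n))) - F (Complex x' (- (real n)))) / \<i>) \<le> 2 * (C * exp (- r * real n) * \<bar>x - x'\<bar>)"
        using edge[of "real n"] edge[of "- real n"]
          norm_triangle_ineq4[of "(F (Complex x (real n)) - F (Complex x' (real n))) / \<i>"
             "(F (Complex x (- (real n))) - F (Complex x' (- (real n)))) / \<i>"]
        by (simp add: norm_divide norm_mult)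
    qed
    have "(\<lambda>n. exp (- r * real n)) \<longlonglongrightarrow> 0"
      using \<open>r > 0\<close> by real_asymp
    thus "(\<lambda>n. 2 * (C * exp (- r * real n) * \<bar>x - x'\<bar>)) \<longlonglongrightarrow> 0"
      by (intro tendsto_mult_right_zero tendsto_mult_left_zero)
  qed
  hence "(\<lambda>n. (F (Complex x (real n)) - F (Complex x (- (real n)))) / \<i> -
              (F (Complex x' (real n)) - F (Complex x' (- (real n)))) / \<i>) \<longlonglongrightarrow> 0"
    by (simp add: algebra_simps diff_divide_distrib)
  from LIMSEQ_unique[OF this tendsto_diff[OF lim[OF x] lim[OF x']]] show ?thesis by simp
qed

section \<open>Wilson's integral\<close>

definition gpair :: "complex \<Rightarrow> complex \<Rightarrow> complex" where
  "gpair p s = Gamma (p + s) * Gamma (p - s)"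

text \<open>Up to the constant -2/pi this is 1 / (Gamma(2s) Gamma(-2s)), the denominator of Wilson's
  weight after reflection.\<close>

definition ssin :: "complex \<Rightarrow> complex" where
  "ssin s = s * sin (2 * of_real pi * s)"

text \<open>The bracketing isolates \<open>gpair p\<close>, the only factor touched by the
  contiguous relation and the limit in \<open>p\<close>. What remains is the integrand for
  continuous dual Hahn polynomials.\<close>

definition wilson_kernel :: "complex \<Rightarrow> complex \<Rightarrow> complex \<Rightarrow> complex \<Rightarrow> complex \<Rightarrow> complex" where
  "wilson_kernel p q r t s = gpair p s * (gpair q s * gpair r s * gpair t s * ssin s)"

definition wilson_integral :: "complex \<Rightarrow> complex \<Rightarrow> complex \<Rightarrow> complex \<Rightarrow> complex" where
  "wilson_integral p q r t = (LINT y|lborel. wilson_kernel p q r t (Complex 0 y))"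

definition dual_hahn_integral :: "complex \<Rightarrow> complex \<Rightarrow> complex \<Rightarrow> complex" where
  "dual_hahn_integral q r t = (LINT y|lborel. gpair q (Complex 0 y) * gpair r (Complex 0 y) * gpair t (Complex 0 y) * ssin (Complex 0 y))"

lemma Re_pos_not_nonpos_Ints: "Re z > 0 \<Longrightarrow> z \<notin> \<int>\<^sub>\<le>\<^sub>0"
  by (auto elim!: nonpos_Ints_cases)

lemma Gamma_nonzero_Re_pos: "Re z > 0 \<Longrightarrow> Gamma z \<noteq> 0"
  by (simp add: Gamma_eq_zero_iff Re_pos_not_nonpos_Ints)

lemma strip_decay_gpair:
  assumes "Re p > a"
  shows "strip_decay (- a) a (14/5) (gpair p)"
proof -
  \<comment> \<open>The rate 7/5 per Gamma factor lies between 4/3 and 3/2: above 4/3, six factors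
    beat the rate -8 granted to \<open>ssin\<close> using pi < 4, and below 3/2 it is under pi/2 by
    pi > 3.\<close>
  have "(7/5 :: real) < pi / 2" using pi_gt3 by simp
  hence "strip_decay (- a) a (7/5 + 7/5) (\<lambda>s. Gamma (p + s) * Gamma (p - s))"
    using assms by (intro strip_decay_mult strip_decay_Gamma_plus strip_decay_Gamma_minus) auto
  thus ?thesis by (simp add: gpair_def[abs_def])
qed

lemma strip_decay_ssin: "strip_decay a b (- 8) ssin"
proof -
  have "strip_decay a b (- (8 - 2 * pi) + - (2 * pi)) ssin"
    unfolding ssin_def[abs_def]
    using pi_less_4 by (intro strip_decay_mult strip_decay_ident strip_decay_sin) auto
  thus ?thesis by simp
qed

lemma strip_decay_dual_hahn:
  assumes "Re q > a" "Re r > a" "Re t > a"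
  shows "strip_decay (- a) a (2/5) (\<lambda>s. gpair q s * gpair r s * gpair t s * ssin s)"
proof -
  have "strip_decay (- a) a (14/5 + 14/5 + 14/5 + - 8) (\<lambda>s. gpair q s * gpair r s * gpair t s * ssin s)"
    using assms by (intro strip_decay_mult strip_decay_gpair strip_decay_ssin) auto
  thus ?thesis by simp
qed

lemma strip_decay_wilson:
  assumes "Re p > a" "Re q > a" "Re r > a" "Re t > a"
  shows "strip_decay (- a) a 3 (wilson_kernel p q r t)"
proof -
  have "strip_decay (- a) a (14/5 + 2/5) (wilson_kernel p q r t)"
    unfolding wilson_kernel_def[abs_def]
    using assms by (intro strip_decay_mult strip_decay_gpair strip_decay_dual_hahn) auto
  thus ?thesis by (rule strip_decay_mono) auto
qed

lemma ex_common_margin: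
  fixes p q r t :: complex
  assumes "Re p > 0" "Re q > 0" "Re r > 0" "Re t > 0"
  obtains a where "a > 0" "Re p > a" "Re q > a" "Re r > a" "Re t > a"
proof -
  define m where "m = Min {Re p, Re q, Re r, Re t}"
  have "m > 0" "m \<le> Re p" "m \<le> Re q" "m \<le> Re r" "m \<le> Re t"
    using assms by (auto simp: m_def)
  thus ?thesis by (intro that[of "m / 2"]) auto
qed

lemma integrable_wilson_kernel:
  assumes "Re p > 0" "Re q > 0" "Re r > 0" "Re t > 0"
  shows "integrable lborel (\<lambda>y. wilson_kernel p q r t (Complex 0 y))"
  using ex_common_margin[OF assms] strip_decay_integrable[OF strip_decay_wilson, of _ p q r t 0] by (metis neg_less_0_iff_less zero_less_numeral)

section \<open>Contiguous relation in the first parameter\<close>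

lemma lborel_integral_uminus:
  fixes f :: "real \<Rightarrow> 'a::{banach, second_countable_topology}"
  shows "(LINT y|lborel. f (- y)) = (LINT y|lborel. f y)"
  using lborel_integral_real_affine[of "-1" f 0] by simp

lemma lborel_integrable_uminus:
  fixes f :: "real \<Rightarrow> 'a::{banach, second_countable_topology}"
  assumes "integrable lborel f"
  shows "integrable lborel (\<lambda>y. f (- y))"
  using lborel_integrable_real_affine[OF assms, of "-1" 0] by simp

text \<open>With p + 1 - s in place of p - s the Gamma product is invariant under s -> 1 - s, while
  the sine changes sign. This reflection maps the line Re s = 1/2 to itself by y -> -y, so the
  integral over that line vanishes; no pole separates it from Re s = 0.\<close>

lemma wilson_null_integral:
  fixes p q r t :: complex
  defines "f \<equiv> (\<lambda>s. Gamma (p + s) * Gamma (p + 1 - s) * (Gamma (q + s) * Gamma (q + 1 - s)) *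
     (Gamma (r + s) * Gamma (r + 1 - s)) * (Gamma (t + s) * Gamma (t + 1 - s)) * sin (2 * of_real pi * s))"
  assumes pos: "Re p > 0" "Re q > 0" "Re r > 0" "Re t > 0"
  shows "integrable lborel (\<lambda>y. f (Complex 0 y))" "(LINT y|lborel. f (Complex 0 y)) = 0"
proof -
  obtain a where a: "a > 0" "Re p > a" "Re q > a" "Re r > a" "Re t > a"
    using ex_common_margin[OF pos] .
  have "(7/5 :: real) < pi / 2" using pi_gt3 by simp
  hence "strip_decay (- a) (1/2 + a) ((7/5 + 7/5) + (7/5 + 7/5) + (7/5 + 7/5) + (7/5 + 7/5) + - (2 * pi)) f"
    unfolding f_def using a
    by (intro strip_decay_mult strip_decay_Gamma_plus strip_decay_Gamma_minus strip_decay_sin) auto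
  hence f: "strip_decay (- a) (1/2 + a) 1 f"
    by (rule strip_decay_mono) (use pi_less_4 in simp)
  show "integrable lborel (\<lambda>y. f (Complex 0 y))"
    using a by (intro strip_decay_integrable[OF f]) auto
  have odd: "f (1 - s) = - f s" for s
  proof -
    have "sin (2 * complex_of_real pi) = 0" "cos (2 * complex_of_real pi) = 1"
      using sin_of_real[of "2 * pi", where ?'a = complex] cos_of_real[of "2 * pi", where ?'a = complex] by simp_all
    hence "sin (2 * of_real pi * (1 - s)) = - sin (2 * of_real pi * s)"
      by (simp add: right_diff_distrib sin_diff)
    moreover have "p + (1 - s) = p + 1 - s" "p + 1 - (1 - s) = p + s" for p by auto
    ultimately show ?thesis unfolding f_def by (simp only:) simp
  qed
  have "(LINT y|lborel. f (Complex (1/2) y)) = (LINT y|lborel. f (Complex (1/2) (- y)))"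
    by (rule lborel_integral_uminus[symmetric])
  also have "\<dots> = (LINT y|lborel. - f (Complex (1/2) y))"
  proof (rule Bochner_Integration.integral_cong)
    fix y
    have "Complex (1/2) (- y) = 1 - Complex (1/2) y" by (simp add: complex_eq_iff)
    thus "f (Complex (1/2) (- y)) = - f (Complex (1/2) y)" by (simp only: odd)
  qed auto
  finally have "(LINT y|lborel. f (Complex (1/2) y)) = 0" by simp
  moreover have "(LINT y|lborel. f (Complex 0 y)) = (LINT y|lborel. f (Complex (1/2) y))"
    using a by (intro strip_decay_shift[OF f]) auto
  ultimately show "(LINT y|lborel. f (Complex 0 y)) = 0" by simp
qed

lemma gpair_plus1:
  assumes "p + s \<notin> \<int>\<^sub>\<le>\<^sub>0" "p - s \<notin> \<int>\<^sub>\<le>\<^sub>0"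
  shows "gpair (p + 1) s = (p + s) * (p - s) * gpair p s"
proof -
  have "Gamma (p + 1 + s) = (p + s) * Gamma (p + s)" "Gamma (p + 1 - s) = (p - s) * Gamma (p - s)"
    using Gamma_plus1[OF assms(1)] Gamma_plus1[OF assms(2)] by (simp_all add: algebra_simps)
  thus ?thesis by (simp add: gpair_def)
qed

lemma wilson_integral_plus1:
  assumes pos: "Re p > 0" "Re q > 0" "Re r > 0" "Re t > 0"
  shows "(p + q + r + t) * wilson_integral (p + 1) q r t
       = (p + q) * (p + r) * (p + t) * wilson_integral p q r t"
proof -
  define f where "f = (\<lambda>s. Gamma (p + s) * Gamma (p + 1 - s) * (Gamma (q + s) * Gamma (q + 1 - s)) *
     (Gamma (r + s) * Gamma (r + 1 - s)) * (Gamma (t + s) * Gamma (t + 1 - s)) * sin (2 * of_real pi * s))"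
  have f: "integrable lborel (\<lambda>y. f (Complex 0 y))" "(LINT y|lborel. f (Complex 0 y)) = 0"
    unfolding f_def by (rule wilson_null_integral[OF pos])+
  have f': "f s = (p - s) * (q - s) * (r - s) * (t - s) * (gpair p s * gpair q s * gpair r s * gpair t s) * sin (2 * of_real pi * s)"
    if "Re s = 0" for s
  proof -
    have "Gamma (p + 1 - s) = (p - s) * Gamma (p - s)" if "Re p > 0" for p
      using Gamma_plus1[OF Re_pos_not_nonpos_Ints, of "p - s"] that \<open>Re s = 0\<close> by (simp add: algebra_simps)
    with pos show ?thesis by (simp add: f_def gpair_def mult_ac)
  qed
  \<comment> \<open>Up to the factor \<open>G\<close>, averaging f(s) and f(-s) leaves the odd part
    -s (e3 + e1 s^2) of (p-s)(q-s)(r-s)(t-s), with e1, e3 the elementary symmetric polynomials of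
    the parameters. The claim then reduces to (p+q)(p+r)(p+t) = p^2 e1 + e3.\<close>
  have kernel: "(p + q + r + t) * wilson_kernel (p + 1) q r t (Complex 0 y)
      = (p + q) * (p + r) * (p + t) * wilson_kernel p q r t (Complex 0 y)
        + (1/2) * (f (Complex 0 y) + f (Complex 0 (- y)))" for y
  proof -
    define s where "s = Complex 0 y"
    have s: "Complex 0 y = s" "Complex 0 (- y) = - s" "Re s = 0" by (auto simp: s_def complex_eq_iff)
    define G where "G = gpair p s * gpair q s * gpair r s * gpair t s * sin (2 * of_real pi * s)"
    have even: "gpair p (- s) = gpair p s" for p by (simp add: gpair_def)
    have 1: "f s = (p - s) * (q - s) * (r - s) * (t - s) * G"
      using f'[of s] s by (simp add: G_def)
    have 2: "f (- s) = - ((p + s) * (q + s) * (r + s) * (t + s) * G)"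
      using f'[of "- s"] s by (simp add: G_def even)
    have "gpair (p + 1) s = (p + s) * (p - s) * gpair p s"
      using pos s by (intro gpair_plus1 Re_pos_not_nonpos_Ints) auto
    hence 3: "wilson_kernel (p + 1) q r t s = (p + s) * (p - s) * s * G"
      by (simp add: wilson_kernel_def ssin_def G_def)
    have 4: "wilson_kernel p q r t s = s * G"
      by (simp add: wilson_kernel_def ssin_def G_def)
    show ?thesis unfolding s 1 2 3 4 by algebra
  qed
  have "(p + q + r + t) * wilson_integral (p + 1) q r t
     = (LINT y|lborel. (p + q + r + t) * wilson_kernel (p + 1) q r t (Complex 0 y))"
    by (simp add: wilson_integral_def)
  also have "\<dots> = (LINT y|lborel. (p + q) * (p + r) * (p + t) * wilson_kernel p q r t (Complex 0 y)
        + (1/2) * (f (Complex 0 y) + f (Complex 0 (- y))))"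
    unfolding kernel ..
  also have "\<dots> = (p + q) * (p + r) * (p + t) * wilson_integral p q r t
       + (1/2) * ((LINT y|lborel. f (Complex 0 y)) + (LINT y|lborel. f (Complex 0 (- y))))"
    using integrable_wilson_kernel[OF pos] f(1) lborel_integrable_uminus[OF f(1)]
    by (simp add: wilson_integral_def)
  also have "(LINT y|lborel. f (Complex 0 (- y))) = 0"
    using lborel_integral_uminus[of "\<lambda>y. f (Complex 0 y)"] f(2) by simp
  finally show ?thesis using f(2) by simp
qed

section \<open>The limit of large first parameter\<close>

lemma norm_Gamma_le_Gamma_Re:
  assumes "Re z > 0"
  shows "norm (Gamma z) \<le> norm (Gamma (complex_of_real (Re z)))"
proof (rule LIMSEQ_le[OF tendsto_norm tendsto_norm])
  show "Gamma_series z \<longlonglongrightarrow> Gamma z" "Gamma_series (complex_of_real (Re z)) \<longlonglongrightarrow> Gamma (complex_of_real (Re z))"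
    by (rule Gamma_series_LIMSEQ)+
  have "norm (Gamma_series z n) \<le> norm (Gamma_series (complex_of_real (Re z)) n)" for n
  proof -
    have "norm (pochhammer (complex_of_real (Re z)) (Suc n)) \<le> norm (pochhammer z (Suc n))"
      unfolding pochhammer_prod prod_norm[symmetric]
    proof (intro prod_mono conjI norm_ge_zero)
      fix k
      have "norm (complex_of_real (Re z) + of_nat k) = \<bar>Re (z + of_nat k)\<bar>"
        using norm_of_real[of "Re z + real k", where ?'a = complex] by simp
      also have "\<dots> \<le> norm (z + of_nat k)" by (rule abs_Re_le_cmod)
      finally show "norm (complex_of_real (Re z) + of_nat k) \<le> norm (z + of_nat k)" .
    qed
    moreover have "norm (pochhammer (complex_of_real (Re z)) (Suc n)) > 0"
    proof -
      have "complex_of_real (Re z) \<noteq> - of_nat k" for k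
        using assms by (auto simp: complex_eq_iff)
      thus ?thesis by (auto simp: pochhammer_eq_0_iff)
    qed
    ultimately show ?thesis
      by (auto simp: Gamma_series_def norm_divide norm_mult intro!: divide_left_mono mult_pos_pos)
  qed
  thus "\<exists>N. \<forall>n\<ge>N. norm (Gamma_series z n) \<le> norm (Gamma_series (complex_of_real (Re z)) n)" by blast
qed

text \<open>The leading behaviour (n-1)! n^z of Gamma(z + n). Being exponential in z, it cancels
  from quotients whose arguments balance; it is nonzero even at n = 0, so no index needs to be
  excluded.\<close>

definition Gamma_scale :: "nat \<Rightarrow> complex \<Rightarrow> complex" where
  "Gamma_scale n z = fact (n - 1) * exp (z * of_real (ln (real n)))"

lemma Gamma_scale_nonzero [simp]: "Gamma_scale n z \<noteq> 0"
  by (simp add: Gamma_scale_def)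

lemma Gamma_shift_asymptotic:
  assumes "z \<notin> \<int>\<^sub>\<le>\<^sub>0"
  shows "(\<lambda>n. Gamma (z + of_nat n) / Gamma_scale n z) \<longlonglongrightarrow> 1"
proof -
  have nz: "Gamma z \<noteq> 0" using assms by (simp add: Gamma_eq_zero_iff)
  have "(\<lambda>n. Gamma z / Gamma_series' z n) \<longlonglongrightarrow> Gamma z / Gamma z"
    by (intro tendsto_intros Gamma_series'_LIMSEQ nz)
  also have "(\<lambda>n. Gamma z / Gamma_series' z n) = (\<lambda>n. Gamma (z + of_nat n) / Gamma_scale n z)"
    using nz by (simp add: fun_eq_iff Gamma_series'_def Gamma_scale_def pochhammer_Gamma[OF assms])
  finally show ?thesis using nz by simp
qed

text \<open>The scales n^s and n^(-s) of the two Gamma factors cancel, so the dependence on s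
  disappears in the limit.\<close>

lemma gpair_shift_tendsto:
  assumes "Re p > 0" "Re s = 0"
  shows "(\<lambda>n. gpair (p + of_nat n) s / (Gamma (p + of_nat n))\<^sup>2) \<longlonglongrightarrow> 1"
proof -
  have "(\<lambda>n. (Gamma (p + s + of_nat n) / Gamma_scale n (p + s)) * (Gamma (p - s + of_nat n) / Gamma_scale n (p - s))
      / (Gamma (p + of_nat n) / Gamma_scale n p)\<^sup>2) \<longlonglongrightarrow> 1 * 1 / 1\<^sup>2"
    using assms by (intro tendsto_intros Gamma_shift_asymptotic Re_pos_not_nonpos_Ints) auto
  also have "(\<lambda>n. (Gamma (p + s + of_nat n) / Gamma_scale n (p + s)) * (Gamma (p - s + of_nat n) / Gamma_scale n (p - s))
      / (Gamma (p + of_nat n) / Gamma_scale n p)\<^sup>2) = (\<lambda>n. gpair (p + of_nat n) s / (Gamma (p + of_nat n))\<^sup>2)"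
  proof
    fix n
    have "Gamma_scale n (p + s) * Gamma_scale n (p - s) = (Gamma_scale n p)\<^sup>2"
      by (simp add: Gamma_scale_def power2_eq_square exp_add[symmetric] algebra_simps)
    moreover have "u / c1 * (v / c2) / (x / c)\<^sup>2 = u * v / x\<^sup>2"
      if "c1 * c2 = c\<^sup>2" "c \<noteq> 0" for u v x c c1 c2 :: complex
      using that by (simp add: power_divide)
    moreover have "Gamma (p + s + of_nat n) * Gamma (p - s + of_nat n) = gpair (p + of_nat n) s"
      by (simp add: gpair_def algebra_simps)
    ultimately show "(Gamma (p + s + of_nat n) / Gamma_scale n (p + s)) * (Gamma (p - s + of_nat n) / Gamma_scale n (p - s))
      / (Gamma (p + of_nat n) / Gamma_scale n p)\<^sup>2 = gpair (p + of_nat n) s / (Gamma (p + of_nat n))\<^sup>2"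
      by (simp add: power_divide)
  qed
  finally show ?thesis by simp
qed

text \<open>This supplies the majorant for dominated convergence. Both factors are at most Gamma(Re
  p + n), and replacing this by |Gamma(p + n)| costs a bounded ratio because n^p and n^(Re p) have
  the same modulus.\<close>

lemma gpair_shift_bounded:
  assumes "Re p > 0"
  obtains B where "\<And>n s. Re s = 0 \<Longrightarrow> norm (gpair (p + of_nat n) s / (Gamma (p + of_nat n))\<^sup>2) \<le> B"
proof -
  let ?x = "complex_of_real (Re p)"
  have "(\<lambda>n. (Gamma (?x + of_nat n) / Gamma_scale n ?x) / (Gamma (p + of_nat n) / Gamma_scale n p)) \<longlonglongrightarrow> 1 / 1"
    using assms by (intro tendsto_intros Gamma_shift_asymptotic Re_pos_not_nonpos_Ints) auto
  hence "Bseq (\<lambda>n. (Gamma (?x + of_nat n) / Gamma_scale n ?x) / (Gamma (p + of_nat n) / Gamma_scale n p))"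
    by (intro convergent_imp_Bseq convergentI)
  then obtain K where K: "\<And>n. norm ((Gamma (?x + of_nat n) / Gamma_scale n ?x) / (Gamma (p + of_nat n) / Gamma_scale n p)) \<le> K"
    unfolding Bseq_def by blast
  have scale: "norm (Gamma_scale n p) = norm (Gamma_scale n ?x)" for n
    by (simp add: Gamma_scale_def norm_mult)
  show ?thesis
  proof (rule that[of "K\<^sup>2"])
    fix n and s :: complex assume s: "Re s = 0"
    have pos: "norm (Gamma (p + of_nat n)) > 0"
      using assms by (simp add: Gamma_nonzero_Re_pos)
    have "norm ((Gamma (?x + of_nat n) / Gamma_scale n ?x) / (Gamma (p + of_nat n) / Gamma_scale n p))
        = norm (Gamma (?x + of_nat n)) / norm (Gamma (p + of_nat n))"
      by (simp add: norm_divide norm_mult scale)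
    with K[of n] have le: "norm (Gamma (?x + of_nat n)) / norm (Gamma (p + of_nat n)) \<le> K" by simp
    have "norm (Gamma (p + of_nat n + s)) \<le> norm (Gamma (?x + of_nat n))"
         "norm (Gamma (p + of_nat n - s)) \<le> norm (Gamma (?x + of_nat n))"
      using norm_Gamma_le_Gamma_Re[of "p + of_nat n + s"] norm_Gamma_le_Gamma_Re[of "p + of_nat n - s"] s assms
      by simp_all
    hence "norm (gpair (p + of_nat n) s) \<le> norm (Gamma (?x + of_nat n)) * norm (Gamma (?x + of_nat n))"
      unfolding gpair_def norm_mult by (intro mult_mono) auto
    hence "norm (gpair (p + of_nat n) s / (Gamma (p + of_nat n))\<^sup>2)
      \<le> (norm (Gamma (?x + of_nat n)) / norm (Gamma (p + of_nat n)))\<^sup>2"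
      using pos by (simp add: norm_divide norm_mult power_divide power2_eq_square divide_right_mono)
    also have "\<dots> \<le> K\<^sup>2"
      using le by (intro power_mono) auto
    finally show "norm (gpair (p + of_nat n) s / (Gamma (p + of_nat n))\<^sup>2) \<le> K\<^sup>2" .
  qed
qed

lemma wilson_integral_shift_tendsto:
  assumes pos: "Re p > 0" "Re q > 0" "Re r > 0" "Re t > 0"
  shows "(\<lambda>n. wilson_integral (p + of_nat n) q r t / (Gamma (p + of_nat n))\<^sup>2) \<longlonglongrightarrow> dual_hahn_integral q r t"
proof -
  obtain a where a: "a > 0" "Re p > a" "Re q > a" "Re r > a" "Re t > a"
    using ex_common_margin[OF pos] .
  obtain B where B: "\<And>n s. Re s = 0 \<Longrightarrow> norm (gpair (p + of_nat n) s / (Gamma (p + of_nat n))\<^sup>2) \<le> B"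
    using gpair_shift_bounded[OF pos(1)] by blast
  define g where "g = (\<lambda>s. gpair q s * gpair r s * gpair t s * ssin s)"
  have g: "integrable lborel (\<lambda>y. g (Complex 0 y))"
    unfolding g_def using a by (intro strip_decay_integrable[OF strip_decay_dual_hahn[OF a(3-5)]]) auto
  define h where "h = (\<lambda>n y. gpair (p + of_nat n) (Complex 0 y) / (Gamma (p + of_nat n))\<^sup>2)"
  have "(\<lambda>n. LINT y|lborel. h n y * g (Complex 0 y)) \<longlonglongrightarrow> (LINT y|lborel. g (Complex 0 y))"
  proof (rule integral_dominated_convergence[where w = "\<lambda>y. B * norm (g (Complex 0 y))"])
    show "integrable lborel (\<lambda>y. B * norm (g (Complex 0 y)))"
      using g by simp
    show "(\<lambda>y. g (Complex 0 y)) \<in> borel_measurable lborel"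
      using g by (rule borel_measurable_integrable)
    fix n
    have "strip_decay (- a) a (14/5) (gpair (p + of_nat n))"
      using a by (intro strip_decay_gpair) auto
    from strip_decay_measurable(2)[OF this, of 0] have "h n \<in> borel_measurable borel"
      using a unfolding h_def by (intro borel_measurable_divide) auto
    thus "(\<lambda>y. h n y * g (Complex 0 y)) \<in> borel_measurable lborel"
      using g by (intro borel_measurable_times) auto
    show "AE y in lborel. norm (h n y * g (Complex 0 y)) \<le> B * norm (g (Complex 0 y))"
      unfolding norm_mult h_def by (intro AE_I2 mult_right_mono B) auto
  next
    show "AE y in lborel. (\<lambda>n. h n y * g (Complex 0 y)) \<longlonglongrightarrow> g (Complex 0 y)"
    proof (rule AE_I2)
      fix y
      have "(\<lambda>n. h n y) \<longlonglongrightarrow> 1"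
        unfolding h_def using pos by (intro gpair_shift_tendsto) auto
      from tendsto_mult_right[OF this, of "g (Complex 0 y)"]
      show "(\<lambda>n. h n y * g (Complex 0 y)) \<longlonglongrightarrow> g (Complex 0 y)" by simp
    qed
  qed
  moreover have "(LINT y|lborel. h n y * g (Complex 0 y)) = wilson_integral (p + of_nat n) q r t / (Gamma (p + of_nat n))\<^sup>2" for n
    by (simp add: h_def g_def wilson_integral_def wilson_kernel_def flip: integral_divide_zero)
  ultimately show ?thesis by (simp add: dual_hahn_integral_def g_def)
qed

lemma wilson_integral_eq_dual_hahn:
  assumes pos: "Re p > 0" "Re q > 0" "Re r > 0" "Re t > 0"
  shows "wilson_integral p q r t * Gamma (p + q + r + t)
       = dual_hahn_integral q r t * (Gamma (p + q) * Gamma (p + r) * Gamma (p + t))"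
proof -
  \<comment> \<open>Normalised so that the contiguous relation says \<open>K (Suc n) = K n\<close>;
    a constant sequence equals its limit.\<close>
  define K where "K = (\<lambda>n. wilson_integral (p + of_nat n) q r t * Gamma (p + q + r + t + of_nat n)
    / (Gamma (p + q + of_nat n) * Gamma (p + r + of_nat n) * Gamma (p + t + of_nat n)))"
  have K_Suc: "K (Suc n) = K n" for n
  proof -
    define p' where "p' = p + of_nat n"
    have p': "Re p' > 0" using pos by (simp add: p'_def)
    have eq: "p + of_nat (Suc n) = p' + 1"
      "p + q + r + t + of_nat (Suc n) = (p' + q + r + t) + 1" "p + q + r + t + of_nat n = p' + q + r + t"
      "p + q + of_nat (Suc n) = (p' + q) + 1" "p + q + of_nat n = p' + q"
      "p + r + of_nat (Suc n) = (p' + r) + 1" "p + r + of_nat n = p' + r"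
      "p + t + of_nat (Suc n) = (p' + t) + 1" "p + t + of_nat n = p' + t"
      by (simp_all add: p'_def)
    have Gamma_eq: "Gamma ((p' + q + r + t) + 1) = (p' + q + r + t) * Gamma (p' + q + r + t)"
      "Gamma ((p' + q) + 1) = (p' + q) * Gamma (p' + q)"
      "Gamma ((p' + r) + 1) = (p' + r) * Gamma (p' + r)"
      "Gamma ((p' + t) + 1) = (p' + t) * Gamma (p' + t)"
      using pos p' by (auto intro!: Gamma_plus1 Re_pos_not_nonpos_Ints)
    have nz: "p' + q \<noteq> 0" "p' + r \<noteq> 0" "p' + t \<noteq> 0"
      using pos p' by (auto simp: complex_eq_iff)
    define S where "S = p' + q + r + t"
    have rel: "S * wilson_integral (p' + 1) q r t = (p' + q) * (p' + r) * (p' + t) * wilson_integral p' q r t"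
      unfolding S_def by (rule wilson_integral_plus1[OF p' pos(2-4)])
    have "K (Suc n) = (S * wilson_integral (p' + 1) q r t) * Gamma S
        / ((p' + q) * (p' + r) * (p' + t) * (Gamma (p' + q) * Gamma (p' + r) * Gamma (p' + t)))"
      unfolding K_def eq Gamma_eq S_def by (simp add: mult_ac)
    also have "\<dots> = wilson_integral p' q r t * Gamma S / (Gamma (p' + q) * Gamma (p' + r) * Gamma (p' + t))"
      unfolding rel using nz by simp
    also have "\<dots> = K n" unfolding K_def eq S_def by (simp add: p'_def)
    finally show ?thesis .
  qed
  have K_const: "K n = K 0" for n by (induction n) (auto simp: K_Suc)
  have "(\<lambda>n. (wilson_integral (p + of_nat n) q r t / (Gamma (p + of_nat n))\<^sup>2) *
     ((Gamma (p + of_nat n) / Gamma_scale n p)\<^sup>2 * (Gamma (p + q + r + t + of_nat n) / Gamma_scale n (p + q + r + t)) /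
     ((Gamma (p + q + of_nat n) / Gamma_scale n (p + q)) * (Gamma (p + r + of_nat n) / Gamma_scale n (p + r)) *
      (Gamma (p + t + of_nat n) / Gamma_scale n (p + t))))) \<longlonglongrightarrow> dual_hahn_integral q r t * (1\<^sup>2 * 1 / (1 * 1 * 1))"
    using pos by (intro tendsto_mult tendsto_divide tendsto_power wilson_integral_shift_tendsto
        Gamma_shift_asymptotic Re_pos_not_nonpos_Ints) auto
  also have "(\<lambda>n. (wilson_integral (p + of_nat n) q r t / (Gamma (p + of_nat n))\<^sup>2) *
     ((Gamma (p + of_nat n) / Gamma_scale n p)\<^sup>2 * (Gamma (p + q + r + t + of_nat n) / Gamma_scale n (p + q + r + t)) /
     ((Gamma (p + q + of_nat n) / Gamma_scale n (p + q)) * (Gamma (p + r + of_nat n) / Gamma_scale n (p + r)) *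
      (Gamma (p + t + of_nat n) / Gamma_scale n (p + t))))) = K"
  proof
    fix n
    \<comment> \<open>The arguments balance, (p+q) + (p+r) + (p+t) = 2p + (p+q+r+t), and three
      factorials stand on either side.\<close>
    have scale: "Gamma_scale n (p + q) * Gamma_scale n (p + r) * Gamma_scale n (p + t)
       = (Gamma_scale n p)\<^sup>2 * Gamma_scale n (p + q + r + t)"
      by (simp add: Gamma_scale_def power2_eq_square exp_add[symmetric] algebra_simps)
    have nz: "Gamma (p + of_nat n) \<noteq> 0" using pos by (intro Gamma_nonzero_Re_pos) auto
    have *: "w / x\<^sup>2 * ((x / cp)\<^sup>2 * (g / cs) / ((u1 / c1) * (u2 / c2) * (u3 / c3))) = w * g / (u1 * u2 * u3)"
      if "c1 * c2 * c3 = cp\<^sup>2 * cs" "x \<noteq> 0" "c1 \<noteq> 0" "c2 \<noteq> 0" "c3 \<noteq> 0" "cp \<noteq> 0" "cs \<noteq> 0"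
      for w x g u1 u2 u3 c1 c2 c3 cp cs :: complex
    proof -
      have "w / x\<^sup>2 * ((x / cp)\<^sup>2 * (g / cs) / ((u1 / c1) * (u2 / c2) * (u3 / c3)))
        = (c1 * c2 * c3 / (cp\<^sup>2 * cs)) * (w * g / (u1 * u2 * u3))"
        using that(2) by (simp add: power_divide)
      thus ?thesis using that by simp
    qed
    show "(wilson_integral (p + of_nat n) q r t / (Gamma (p + of_nat n))\<^sup>2) *
     ((Gamma (p + of_nat n) / Gamma_scale n p)\<^sup>2 * (Gamma (p + q + r + t + of_nat n) / Gamma_scale n (p + q + r + t)) /
     ((Gamma (p + q + of_nat n) / Gamma_scale n (p + q)) * (Gamma (p + r + of_nat n) / Gamma_scale n (p + r)) *
      (Gamma (p + t + of_nat n) / Gamma_scale n (p + t)))) = K n"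
      unfolding K_def by (rule *[OF scale nz]) auto
  qed
  finally have "K \<longlonglongrightarrow> dual_hahn_integral q r t" by simp
  moreover have "K = (\<lambda>_. K 0)" using K_const by (simp add: fun_eq_iff)
  ultimately have "K 0 = dual_hahn_integral q r t"
    by (metis LIMSEQ_const_iff)
  moreover have "Gamma (p + q) * Gamma (p + r) * Gamma (p + t) \<noteq> 0"
    using pos by (simp add: Gamma_nonzero_Re_pos)
  ultimately show ?thesis by (simp add: K_def field_simps)
qed

section \<open>Independence of all parameters\<close>

definition wilson_gammas :: "complex \<Rightarrow> complex \<Rightarrow> complex \<Rightarrow> complex \<Rightarrow> complex" where
  "wilson_gammas p q r t = Gamma (p + q) * Gamma (p + r) * Gamma (p + t) * Gamma (q + r) * Gamma (q + t) * Gamma (r + t)"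

lemma wilson_gammas_nonzero:
  assumes "Re p > 0" "Re q > 0" "Re r > 0" "Re t > 0"
  shows "wilson_gammas p q r t \<noteq> 0"
  using assms by (simp add: wilson_gammas_def Gamma_nonzero_Re_pos)

definition wilson_ratio :: "complex \<Rightarrow> complex \<Rightarrow> complex \<Rightarrow> complex \<Rightarrow> complex" where
  "wilson_ratio p q r t = wilson_integral p q r t * Gamma (p + q + r + t) / wilson_gammas p q r t"

lemma wilson_ratio_commute:
  "wilson_ratio p q r t = wilson_ratio q p r t"
  "wilson_ratio p q r t = wilson_ratio r q p t"
  "wilson_ratio p q r t = wilson_ratio t q r p"
  unfolding wilson_ratio_def wilson_integral_def wilson_kernel_def wilson_gammas_def by (simp_all add: ac_simps)

text \<open>By \<open>wilson_integral_eq_dual_hahn\<close> the three Gammas involving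
  \<open>p\<close> cancel, and what is left mentions only \<open>q\<close>, \<open>r\<close>,
  \<open>t\<close>.\<close>

lemma wilson_ratio_indep:
  assumes "Re p > 0" "Re p' > 0" "Re q > 0" "Re r > 0" "Re t > 0"
  shows "wilson_ratio p q r t = wilson_ratio p' q r t"
proof -
  have "wilson_ratio p q r t = dual_hahn_integral q r t / (Gamma (q + r) * Gamma (q + t) * Gamma (r + t))"
    if "Re p > 0" for p
  proof -
    have "Gamma (p + q) * Gamma (p + r) * Gamma (p + t) \<noteq> 0"
      using that assms by (simp add: Gamma_nonzero_Re_pos)
    thus ?thesis
      by (simp add: wilson_ratio_def wilson_integral_eq_dual_hahn[OF that assms(3-5)] wilson_gammas_def mult.assoc)
  qed
  from this[OF assms(1)] this[OF assms(2)] show ?thesis by simp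
qed

text \<open>Independence is known in the first position only, so each parameter is swapped there in
  turn and replaced.\<close>

lemma wilson_ratio_const:
  assumes "Re p > 0" "Re q > 0" "Re r > 0" "Re t > 0" "Re p' > 0" "Re q' > 0" "Re r' > 0" "Re t' > 0"
  shows "wilson_ratio p q r t = wilson_ratio p' q' r' t'"
proof -
  have "wilson_ratio p q r t = wilson_ratio p' q r t" by (intro wilson_ratio_indep assms)
  also have "\<dots> = wilson_ratio q p' r t" by (rule wilson_ratio_commute)
  also have "\<dots> = wilson_ratio q' p' r t" by (intro wilson_ratio_indep assms)
  also have "\<dots> = wilson_ratio r p' q' t" by (rule wilson_ratio_commute)
  also have "\<dots> = wilson_ratio r' p' q' t" by (intro wilson_ratio_indep assms)
  also have "\<dots> = wilson_ratio t p' q' r'" by (rule wilson_ratio_commute)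
  also have "\<dots> = wilson_ratio t' p' q' r'" by (intro wilson_ratio_indep assms)
  also have "\<dots> = wilson_ratio p' q' r' t'"
    by (metis wilson_ratio_commute)
  finally show ?thesis .
qed

section \<open>The special case 1/2, 1, 1/4, 3/4\<close>

lemma gpair_half: "gpair (1/2) s = of_real pi / cos (of_real pi * s)"
proof -
  have "gpair (1/2) s = Gamma (1/2 + s) * Gamma (1 - (1/2 + s))"
    by (simp add: gpair_def algebra_simps)
  also have "\<dots> = of_real pi / sin (of_real pi / 2 + of_real pi * s)"
    by (subst Gamma_reflection_complex) (simp add: algebra_simps)
  finally show ?thesis by (simp add: sin_add)
qed

lemma gpair_one:
  assumes "s \<notin> \<int>\<^sub>\<le>\<^sub>0"
  shows "gpair 1 s = of_real pi * s / sin (of_real pi * s)"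
proof -
  have "gpair 1 s = s * (Gamma s * Gamma (1 - s))"
    using Gamma_plus1[OF assms] by (simp add: gpair_def add.commute)
  thus ?thesis by (simp add: Gamma_reflection_complex)
qed

lemma gpair_quarters: "gpair (1/4) s * gpair (3/4) s = 2 * (of_real pi)\<^sup>2 / cos (2 * of_real pi * s)"
proof -
  let ?x = "of_real pi * s" let ?q = "complex_of_real pi / 4"
  have eq: "1 - (1/4 + s) = 3/4 - s" "1 - (1/4 - s) = 3/4 + s" by auto
  have "gpair (1/4) s * gpair (3/4) s = (Gamma (1/4 + s) * Gamma (1 - (1/4 + s))) * (Gamma (1/4 - s) * Gamma (1 - (1/4 - s)))"
    unfolding eq by (simp add: gpair_def)
  also have "\<dots> = of_real pi / sin (of_real pi * (1/4 + s)) * (of_real pi / sin (of_real pi * (1/4 - s)))"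
    by (simp only: Gamma_reflection_complex)
  also have "of_real pi * (1/4 + s) = ?q + ?x" by (simp add: algebra_simps)
  also have "of_real pi * (1/4 - s) = ?q - ?x" by (simp add: algebra_simps)
  also have "of_real pi / sin (?q + ?x) * (of_real pi / sin (?q - ?x)) = (of_real pi)\<^sup>2 / (sin (?q + ?x) * sin (?q - ?x))"
    by (simp add: power2_eq_square)
  also have "sin (?q + ?x) * sin (?q - ?x) = (cos (2 * ?x) - cos (2 * ?q)) / 2"
    by (subst sin_times_sin) (simp add: algebra_simps)
  also have "2 * ?q = of_real (pi / 2)" by simp
  also have "cos (of_real (pi / 2)) = (0::complex)" using cos_of_real[of "pi / 2", where ?'a = complex] by (simp del: of_real_divide)
  finally show ?thesis by (simp add: mult.assoc)
qed

text \<open>\<open>h\<close> is 2 pi^2 s^2 / sin(2 pi s); its Gamma form has the singularity at 0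
  already removed. The integrals of \<open>h\<close> over Re s = 1/4 and Re s = -1/4 agree, while
  the integrands differ by a multiple of (1/8 - 2 y^2) / cosh(2 pi y). This trades y^2 for the known
  integral of 1 / cosh.\<close>

lemma integral_square_sech:
  "integrable lborel (\<lambda>y::real. y\<^sup>2 / cosh (2 * pi * y))"
  "(LINT y|lborel. y\<^sup>2 / cosh (2 * pi * y)) = 1 / 32"
proof -
  define h where "h = (\<lambda>s. gpair (1/2) s * gpair 1 s * s)"
  \<comment> \<open>The half-width 3/8 lies between the lines at distance 1/4 and the poles of
    \<open>gpair (1/2)\<close> at distance 1/2.\<close>
  have "strip_decay (- (3/8)) (3/8) (14/5 + 14/5 + - 1) h"
    unfolding h_def by (intro strip_decay_mult strip_decay_gpair strip_decay_ident) auto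
  hence decay: "strip_decay (- (3/8)) (3/8) 1 h" by (rule strip_decay_mono) auto
  have h_eq: "h s = 2 * (of_real pi)\<^sup>2 * s\<^sup>2 / sin (2 * of_real pi * s)" if "s \<notin> \<int>\<^sub>\<le>\<^sub>0" for s
  proof -
    have "sin (2 * of_real pi * s) = 2 * sin (of_real pi * s) * cos (of_real pi * s)"
      by (metis mult.assoc sin_double)
    thus ?thesis
      unfolding h_def gpair_half gpair_one[OF that] by (simp add: power2_eq_square mult_ac)
  qed
  define g where "g = (\<lambda>y::real. (1/8 - 2 * y\<^sup>2) / cosh (2 * pi * y))"
  have diff: "h (Complex (1/4) y) - h (Complex (-1/4) y) = of_real (2 * pi\<^sup>2 * g y)" for y
  proof -
    have arg: "2 * of_real pi * Complex (1/4) y = of_real (pi / 2) + \<i> * of_real (2 * pi * y)"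
      "2 * of_real pi * Complex (-1/4) y = - of_real (pi / 2) + \<i> * of_real (2 * pi * y)"
      by (simp_all add: complex_eq_iff)
    have trig: "sin (complex_of_real (pi / 2)) = 1" "cos (complex_of_real (pi / 2)) = 0"
      unfolding sin_of_real cos_of_real by simp_all
    have "sin (2 * of_real pi * Complex (1/4) y) = of_real (cosh (2 * pi * y))"
      "sin (2 * of_real pi * Complex (-1/4) y) = - of_real (cosh (2 * pi * y))"
      unfolding arg sin_add cos_i_times sin_minus cos_minus trig by simp_all
    moreover have "Complex (1/4) y \<notin> \<int>\<^sub>\<le>\<^sub>0" by (simp add: Re_pos_not_nonpos_Ints)
    moreover have "Complex (-1/4) y \<notin> \<int>\<^sub>\<le>\<^sub>0"
    proof
      assume "Complex (-1/4) y \<in> \<int>\<^sub>\<le>\<^sub>0"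
      then obtain n where "Complex (-1/4) y = of_int n" by (auto elim!: nonpos_Ints_cases)
      hence "real_of_int (4 * n) = - 1" by (simp add: complex_eq_iff)
      hence "4 * n = - 1" by linarith
      thus False by presburger
    qed
    ultimately have "h (Complex (1/4) y) - h (Complex (-1/4) y)
      = 2 * (of_real pi)\<^sup>2 * ((Complex (1/4) y)\<^sup>2 + (Complex (-1/4) y)\<^sup>2) / of_real (cosh (2 * pi * y))"
      by (simp add: h_eq add_divide_distrib distrib_left)
    also have "(Complex (1/4) y)\<^sup>2 + (Complex (-1/4) y)\<^sup>2 = of_real (1/8 - 2 * y\<^sup>2)"
      by (simp add: complex_eq_iff power2_eq_square)
    finally show ?thesis by (simp add: g_def)
  qed
  have int: "integrable lborel (\<lambda>y. h (Complex (1/4) y))" "integrable lborel (\<lambda>y. h (Complex (-1/4) y))"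
    by (intro strip_decay_integrable[OF decay]; simp)+
  have "(LINT y|lborel. h (Complex (1/4) y)) = (LINT y|lborel. h (Complex (-1/4) y))"
    by (intro strip_decay_shift[OF decay]) auto
  hence int0: "(LINT y|lborel. complex_of_real (2 * pi\<^sup>2 * g y)) = 0"
    using int unfolding diff[symmetric] by simp
  have "integrable lborel (\<lambda>y. complex_of_real (2 * pi\<^sup>2 * g y))"
    using int unfolding diff[symmetric] by simp
  from integrable_Re[OF this] have "integrable lborel (\<lambda>y. 2 * pi\<^sup>2 * g y)"
    by (simp only: Re_complex_of_real)
  hence g_int: "integrable lborel g" by simp
  from int0 have g0: "(LINT y|lborel. g y) = 0"
    unfolding integral_complex_of_real by simp
  have eq: "(\<lambda>y::real. y\<^sup>2 / cosh (2 * pi * y)) = (\<lambda>y. (1/16) * (1 / cosh (2 * pi * y)) - (1/2) * g y)"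
    by (simp add: g_def fun_eq_iff diff_divide_distrib)
  have "has_bochner_integral lborel (\<lambda>y. (1/16) * (1 / cosh (2 * pi * y)) - (1/2) * g y)
      ((1/16) * (pi / (2 * pi)) - (1/2) * 0)"
    using has_bochner_integral_sech[of "2 * pi"] g_int g0
    by (intro has_bochner_integral_diff has_bochner_integral_mult_right) (auto simp: has_bochner_integral_iff)
  thus "integrable lborel (\<lambda>y::real. y\<^sup>2 / cosh (2 * pi * y))"
    "(LINT y|lborel. y\<^sup>2 / cosh (2 * pi * y)) = 1 / 32"
    unfolding eq by (simp_all only: has_bochner_integral_iff) simp
qed

text \<open>For these parameters the reflection formula removes every Gamma function, and the sine
  of \<open>ssin\<close> cancels sin(pi s) cos(pi s), leaving 4 pi^4 s^2 / cos(2 pi s).\<close>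

lemma wilson_integral_special: "wilson_integral (1/2) 1 (1/4) (3/4) = - (of_real pi ^ 4) / 8"
proof -
  have "wilson_kernel (1/2) 1 (1/4) (3/4) (Complex 0 y) = of_real (- 4 * pi ^ 4 * (y\<^sup>2 / cosh (2 * pi * y)))" for y
  proof (cases "y = 0")
    case True
    thus ?thesis by (simp add: wilson_kernel_def ssin_def zero_complex.code[symmetric])
  next
    case False
    define s where "s = Complex 0 y"
    have s: "of_real pi * s = \<i> * of_real (pi * y)" "2 * of_real pi * s = \<i> * of_real (2 * pi * y)"
      "s\<^sup>2 = - of_real (y\<^sup>2)"
      by (simp_all add: s_def complex_eq_iff power2_eq_square)
    have nz: "sin (of_real pi * s) \<noteq> 0" "cos (of_real pi * s) \<noteq> 0"
      unfolding s sin_i_times cos_i_times using False by simp_all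
    have "s \<notin> \<int>\<^sub>\<le>\<^sub>0" using False by (auto elim!: nonpos_Ints_cases simp: s_def complex_eq_iff)
    note gpair1 = gpair_one[OF this]
    have double: "sin (2 * of_real pi * s) = 2 * sin (of_real pi * s) * cos (of_real pi * s)"
      by (metis mult.assoc sin_double)
    have "wilson_kernel (1/2) 1 (1/4) (3/4) s
      = gpair (1/2) s * gpair 1 s * (gpair (1/4) s * gpair (3/4) s) * ssin s"
      by (simp add: wilson_kernel_def)
    also have "\<dots> = 4 * of_real pi ^ 4 * s\<^sup>2 / cos (2 * of_real pi * s)"
      unfolding gpair_half gpair1 gpair_quarters ssin_def double using nz
      by (simp add: power2_eq_square power4_eq_xxxx)
    also have "\<dots> = of_real (- 4 * pi ^ 4 * (y\<^sup>2 / cosh (2 * pi * y)))"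
      unfolding s cos_i_times by simp
    finally show ?thesis by (simp add: s_def)
  qed
  hence "wilson_integral (1/2) 1 (1/4) (3/4) = (LINT y|lborel. complex_of_real (- 4 * pi ^ 4 * (y\<^sup>2 / cosh (2 * pi * y))))"
    by (simp only: wilson_integral_def)
  also have "\<dots> = of_real (- 4 * pi ^ 4 * (1 / 32))"
    unfolding integral_complex_of_real integral_mult_right_zero integral_square_sech ..
  finally show ?thesis by simp
qed

lemma wilson_ratio_value: "wilson_ratio (1/2) 1 (1/4) (3/4) = - 2 * (of_real pi)\<^sup>2"
proof -
  have not_int: "z \<notin> \<int>\<^sub>\<le>\<^sub>0" if "Re z > 0" for z using that by (rule Re_pos_not_nonpos_Ints)
  let ?A = "Gamma (1/4) * Gamma (3/4) :: complex"
  have "Gamma (5/2) = (3/2 :: complex) * Gamma (3/2)"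
    "Gamma (5/4) = (1/4 :: complex) * Gamma (1/4)" "Gamma (7/4) = (3/4 :: complex) * Gamma (3/4)"
    using Gamma_plus1[OF not_int, of "3/2"] Gamma_plus1[OF not_int, of "1/4"] Gamma_plus1[OF not_int, of "3/4"] by simp_all
  note shifts = this
  have "?A = of_real pi / sin (of_real (pi / 4))"
    using Gamma_reflection_complex[of "1/4"] by simp
  also have "sin (complex_of_real (pi / 4)) = of_real (sqrt 2 / 2)"
    unfolding sin_of_real by (simp add: sin_45)
  finally have "?A ^ 2 = (of_real pi)\<^sup>2 / (of_real (sqrt 2 / 2))\<^sup>2" by (simp only: power_divide)
  also have "(complex_of_real (sqrt 2 / 2))\<^sup>2 = of_real ((sqrt 2 / 2)\<^sup>2)" by (simp only: of_real_power)
  also have "(sqrt 2 / 2)\<^sup>2 = 1 / 2" by (simp add: power_divide)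
  finally have A: "?A ^ 2 = 2 * (of_real pi)\<^sup>2" by simp
  \<comment> \<open>The pair sums are 3/2, 3/4, 5/4, 5/4, 7/4, 1. The remaining Gamma(3/2) cancels
    against Gamma(5/2) of the total sum.\<close>
  have "wilson_gammas (1/2) 1 (1/4) (3/4) = (3/64) * Gamma (3/2) * ?A ^ 2"
    unfolding wilson_gammas_def by (simp add: shifts power2_eq_square)
  hence gammas: "wilson_gammas (1/2) 1 (1/4) (3/4) = (3/32) * Gamma (3/2) * (of_real pi)\<^sup>2" by (simp add: A)
  have "Gamma (3/2 :: complex) \<noteq> 0" by (intro Gamma_nonzero_Re_pos) simp
  thus ?thesis
    unfolding wilson_ratio_def wilson_integral_special gammas
    by (simp add: shifts power4_eq_xxxx power2_eq_square)
qed

theorem wilson_integral_eq: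
  assumes "Re p > 0" "Re q > 0" "Re r > 0" "Re t > 0"
  shows "wilson_integral p q r t = - 2 * (of_real pi)\<^sup>2 * wilson_gammas p q r t / Gamma (p + q + r + t)"
proof -
  have "wilson_ratio p q r t = - 2 * (of_real pi)\<^sup>2"
    unfolding wilson_ratio_value[symmetric] using assms by (intro wilson_ratio_const) auto
  moreover have "Gamma (p + q + r + t) \<noteq> 0" using assms by (intro Gamma_nonzero_Re_pos) auto
  ultimately show ?thesis
    using wilson_gammas_nonzero[OF assms] by (simp add: wilson_ratio_def field_simps)
qed

section \<open>The recurrence coefficients\<close>

text \<open>The subtraction is complex, so the value is given by a rational function of
  \<open>i\<close>; for i < m the factor k = i makes it zero. At i = 0 this is the source of the
  vanishing moments.\<close>

definition falling_ratio :: "complex \<Rightarrow> nat \<Rightarrow> nat \<Rightarrow> complex" where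
  "falling_ratio S m i = (\<Prod>k<m. of_nat i - of_nat k) / pochhammer (S + of_nat i) m"

lemma falling_ratio_0 [simp]: "falling_ratio S 0 i = 1"
  by (simp add: falling_ratio_def)

lemma falling_ratio_Suc:
  "falling_ratio S (Suc m) i = falling_ratio S m i * (of_nat i - of_nat m) / (S + of_nat i + of_nat m)"
  by (simp add: falling_ratio_def pochhammer_Suc)

lemma falling_prod_Suc: "(\<Prod>k<Suc m. of_nat (Suc i) - of_nat k :: complex) = of_nat (Suc i) * (\<Prod>k<m. of_nat i - of_nat k)"
  by (subst prod.lessThan_Suc_shift) simp

text \<open>Brings a value of \<open>L\<close> at \<open>Suc i\<close> back to index
  \<open>i\<close>, in the normalisation S + 1 of \<open>L'\<close>.\<close>

lemma falling_ratio_Suc_Suc: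
  "falling_ratio S (Suc m) (Suc i) = falling_ratio (S + 1) m i * (of_nat i + 1) / (S + of_nat i + 1 + of_nat m)"
  unfolding falling_ratio_def falling_prod_Suc
  by (simp add: pochhammer_Suc algebra_simps)

text \<open>Translates between the normalisations S of \<open>L\<close> and S + 1 of
  \<open>L'\<close> at the same index.\<close>

lemma falling_ratio_shift:
  assumes "Re S > 0"
  shows "falling_ratio (S + 1) m i = falling_ratio S m i * (S + of_nat i) / (S + of_nat i + of_nat m)"
proof -
  have nz: "S + of_nat i + of_nat k \<noteq> 0" for k :: nat
    using assms by (auto simp: complex_eq_iff)
  have *: "pochhammer (S + of_nat i) m * (S + of_nat i + of_nat m) = (S + of_nat i) * pochhammer (S + 1 + of_nat i) m"
    using pochhammer_Suc[of "S + of_nat i" m] pochhammer_rec[of "S + of_nat i" m] by (simp add: add_ac)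
  have "S + of_nat i \<noteq> 0" using nz[of 0] by simp
  thus ?thesis
    unfolding falling_ratio_def by (simp add: *)
qed

text \<open>\<open>S\<close> is tied to the parameters by an equation, so denominators stay atomic
  until a polynomial identity is reached. Re S > 1 keeps 2m + S - 1, the denominator in
  \<open>C_even\<close>, nonzero at m = 0.\<close>

locale bi_params =
  fixes a b c d S :: complex
  assumes S_eq: "S = a + b + c + d + 2" and S_pos: "Re S > 1"
begin

lemma denominators_nonzero: "2 * of_nat m + S \<noteq> 0" "2 * of_nat m + 1 + S \<noteq> 0" "2 * of_nat m + S - 1 \<noteq> 0" "S + of_nat i + of_nat m \<noteq> 0" "S + of_nat i \<noteq> 0"
  "S + of_nat i + 1 + of_nat m \<noteq> 0"
  using S_pos by (auto simp: complex_eq_iff)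

lemma A_even: "BI_A a b c d (2 * m) = 2 * (of_nat m + a + c + 1) * (of_nat m + a + d + 1) / (2 * of_nat m + S)"
proof -
  have *: "of_nat (2 * m) + 2 * a + 2 * c + 2 = 2 * (of_nat m + a + c + 1)"
    "of_nat (2 * m) + 2 * a + 2 * d + 2 = 2 * (of_nat m + a + d + 1)"
    "of_nat (2 * m) + a + b + c + d + 2 = 2 * of_nat m + S"
    by (simp_all add: S_eq)
  show ?thesis by (simp add: BI_A_def * del: of_nat_mult distrib_left_numeral right_diff_distrib_numeral)
qed

lemma A_odd: "BI_A a b c d (Suc (2 * m)) = (2 * of_nat m + 2 * a + 2 * b + 3) * (of_nat m + S) / (2 * of_nat m + 1 + S)"
proof -
  have *: "of_nat (Suc (2 * m)) + 2 * a + 2 * b + 2 = 2 * of_nat m + 2 * a + 2 * b + 3"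
    "of_nat (Suc (2 * m)) + 2 * a + 2 * b + 2 * c + 2 * d + 3 = 2 * (of_nat m + S)"
    "of_nat (Suc (2 * m)) + a + b + c + d + 2 = 2 * of_nat m + 1 + S"
    by (simp_all add: S_eq)
  show ?thesis by (simp add: BI_A_def * del: of_nat_mult of_nat_Suc distrib_left_numeral right_diff_distrib_numeral)
qed

lemma C_even: "BI_C a b c d (2 * m) = - (of_nat m * (2 * of_nat m + 2 * c + 2 * d + 1) / (2 * of_nat m + S - 1))"
proof -
  have *: "of_nat (2 * m) * (of_nat (2 * m) + 2 * c + 2 * d + 1) = 2 * (of_nat m * (2 * of_nat m + 2 * c + 2 * d + 1))"
    "of_nat (2 * m) + a + b + c + d + 1 = 2 * of_nat m + S - 1"
    by (simp_all add: S_eq)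
  show ?thesis by (simp add: BI_C_def * del: of_nat_mult distrib_left_numeral right_diff_distrib_numeral)
qed

lemma C_odd: "BI_C a b c d (Suc (2 * m)) = - (2 * (of_nat m + b + c + 1) * (of_nat m + b + d + 1) / (2 * of_nat m + S))"
proof -
  have *: "of_nat (Suc (2 * m)) + 2 * b + 2 * c + 1 = 2 * (of_nat m + b + c + 1)"
    "of_nat (Suc (2 * m)) + 2 * b + 2 * d + 1 = 2 * (of_nat m + b + d + 1)"
    "of_nat (Suc (2 * m)) + a + b + c + d + 1 = 2 * of_nat m + S"
    by (simp_all add: S_eq)
  show ?thesis by (simp add: BI_C_def * del: of_nat_mult of_nat_Suc distrib_left_numeral right_diff_distrib_numeral)
qed

text \<open>The ratio of the leading constants of the closed form in \<open>moments_bannai_ito\<close> at \<open>2 * m + 1\<close> and \<open>2 * m\<close>.\<close>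

definition G :: "nat \<Rightarrow> complex" where
  "G m = - (2 * (of_nat m + a + d + 1) * (of_nat m + b + d + 1) / (2 * of_nat m + S))"

definition \<beta> :: "nat \<Rightarrow> complex" where
  "\<beta> n = 2 * a + 1 - BI_A a b c d n - BI_C a b c d n"

text \<open>\<open>G m\<close> takes the two factors containing \<open>d\<close> and leaves the two
  containing \<open>c\<close>; the \<open>G m\<close> in the closed form at degree 2m + 1 can then
  be divided out of the recurrence.\<close>

lemma AC_odd: "BI_A a b c d (2 * m) * BI_C a b c d (Suc (2 * m))
  = G m * (2 * (of_nat m + a + c + 1) * (of_nat m + b + c + 1) / (2 * of_nat m + S))"
  unfolding A_even C_odd G_def divide_inverse by algebra

text \<open>What remains of the recurrence once the closed form is inserted and common factors are
  divided out. The first word of the name is the parity of the degree reached, the second is even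
  for \<open>L\<close> and odd for \<open>L'\<close>. Here the \<open>A\<close> inside
  \<open>\<beta>\<close> cancels the right-hand side.\<close>

lemma step_even_even:
  "(2 * (a + c + of_nat i + 1) * (b + c + of_nat i + 1) / (S + of_nat i)) * ((S + of_nat i) / (S + of_nat i + of_nat m))
   - (2 * (c + of_nat i) + 1 + \<beta> (Suc (2 * m))) * ((of_nat i - of_nat m) / (S + of_nat i + of_nat m))
   - 2 * (of_nat m + a + c + 1) * (of_nat m + b + c + 1) / (2 * of_nat m + S)
   = BI_A a b c d (Suc (2 * m)) * ((of_nat i - of_nat m) / (S + of_nat i + of_nat m))"
proof -
  define T where "T = 2 * of_nat m + S"
  define U where "U = S + of_nat i + of_nat m"
  define V where "V = S + of_nat i"
  define A where "A = BI_A a b c d (Suc (2 * m))"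
  define D :: complex where "D = of_nat i - of_nat m"
  define X where "X = 2 * (a + c + of_nat i + 1) * (b + c + of_nat i + 1)"
  define Y where "Y = 2 * (of_nat m + b + c + 1) * (of_nat m + b + d + 1)"
  define Z where "Z = 2 * (of_nat m + a + c + 1) * (of_nat m + b + c + 1)"
  define k where "k = 2 * (c + of_nat i) + 1"
  have nz: "T \<noteq> 0" "U \<noteq> 0" "V \<noteq> 0" unfolding T_def U_def V_def using denominators_nonzero by simp_all
  have b: "\<beta> (Suc (2 * m)) = 2 * a + 1 - A + Y / T"
    unfolding \<beta>_def C_odd A_def T_def Y_def by simp
  have "X * T - ((k + 2 * a + 1) * T + Y) * D = Z * U"
    unfolding T_def U_def D_def X_def Y_def Z_def k_def S_eq by algebra
  hence "X / U - (k + (2 * a + 1 + Y / T)) * (D / U) = Z / T"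
    using nz by (simp add: divide_simps) algebra
  hence "X / V * (V / U) - (k + (2 * a + 1 - A + Y / T)) * (D / U) - Z / T = A * (D / U)"
    using nz by (simp add: algebra_simps)
  thus ?thesis
    unfolding b T_def U_def V_def A_def D_def X_def Z_def k_def .
qed

text \<open>Now \<open>A\<close> does not cancel but occurs as A (U - D) / U, and U - D = T' is
  exactly the denominator of \<open>A_odd\<close>.\<close>

lemma step_even_odd:
  "- 2 * (c + d + of_nat i + 3/2) * ((of_nat i + 1) / (S + of_nat i + 1 + of_nat m))
   + (2 * (c + of_nat i) + 2 - \<beta> (Suc (2 * m)))
   - 2 * (of_nat m + a + c + 1) * (of_nat m + b + c + 1) / (2 * of_nat m + S)
   = BI_A a b c d (Suc (2 * m)) * ((of_nat i - of_nat m) / (S + 1 + of_nat i + of_nat m))"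
proof -
  define T where "T = 2 * of_nat m + S"
  define T' where "T' = 2 * of_nat m + 1 + S"
  define U where "U = S + 1 + of_nat i + of_nat m"
  define A where "A = BI_A a b c d (Suc (2 * m))"
  define D :: complex where "D = of_nat i - of_nat m"
  define Q where "Q = 2 * (of_nat m + b + c + 1)"
  define X where "X = - 2 * (c + d + of_nat i + 3/2) * (of_nat i + 1)"
  define k where "k = 2 * (c + of_nat i) + 2"
  have U': "S + of_nat i + 1 + of_nat m = U" by (simp add: U_def)
  have nz: "T \<noteq> 0" "T' \<noteq> 0" "U \<noteq> 0" unfolding T_def T'_def U'[symmetric] using denominators_nonzero by simp_all
  have AT: "A * T' = (2 * of_nat m + 2 * a + 2 * b + 3) * (of_nat m + S)"
    using nz unfolding A_def A_odd T'_def by simp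
  have D: "U - D = T'" by (simp add: U_def D_def T'_def)
  have "Q * (of_nat m + b + d + 1) + 2 * (of_nat m + a + c + 1) * (of_nat m + b + c + 1) = Q * T"
    unfolding T_def Q_def S_eq by algebra
  hence "Q * (of_nat m + b + d + 1) / T + 2 * (of_nat m + a + c + 1) * (of_nat m + b + c + 1) / T = Q"
    using nz by (simp only: add_divide_distrib[symmetric]) simp
  hence "\<beta> (Suc (2 * m)) + 2 * (of_nat m + a + c + 1) * (of_nat m + b + c + 1) / T = 2 * a + 1 - A + Q"
    using nz unfolding \<beta>_def C_odd A_def T_def[symmetric] Q_def by simp
  moreover have "X + (k - 2 * a - 1 - Q) * U + A * T' = 0"
    unfolding AT unfolding U_def X_def Q_def k_def S_eq by (simp add: field_simps)
  hence "X + (k - (2 * a + 1 - A + Q)) * U = A * D"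
    using D by algebra
  hence "(X + (k - (2 * a + 1 - A + Q)) * U) / U = A * D / U" by simp
  hence "X / U + (k - (2 * a + 1 - A + Q)) = A * D / U"
    using nz by (simp add: add_divide_distrib)
  moreover have "- 2 * (c + d + of_nat i + 3/2) * ((of_nat i + 1) / U) = X / U" by (simp add: X_def)
  moreover have "p + z = q \<Longrightarrow> x + (k - q) = y \<Longrightarrow> x + (k - p) - z = y" for p q x y z :: complex
    by auto
  ultimately show ?thesis
    unfolding U' unfolding T_def[symmetric] U_def[symmetric] A_def[symmetric] D_def[symmetric] k_def[symmetric]
    by (simp only: times_divide_eq_right)
qed

text \<open>The coefficient C cancels against the one inside \<open>\<beta>\<close>. The instance m
  = 0 also serves degree 1.\<close>

lemma step_odd_even:
  "(2 * (a + c + of_nat i + 1) * (b + c + of_nat i + 1) / (S + of_nat i)) * ((S + of_nat i) / (S + of_nat i + of_nat m))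
   - (2 * (c + of_nat i) + 1 + \<beta> (2 * m)) - BI_C a b c d (2 * m)
   = G m * ((of_nat i - of_nat m) / (S + of_nat i + of_nat m))"
proof -
  define T where "T = 2 * of_nat m + S"
  define U where "U = S + of_nat i + of_nat m"
  define V where "V = S + of_nat i"
  define D :: complex where "D = of_nat i - of_nat m"
  define X where "X = 2 * (a + c + of_nat i + 1) * (b + c + of_nat i + 1)"
  define Y where "Y = 2 * (of_nat m + a + c + 1) * (of_nat m + a + d + 1)"
  define Z where "Z = 2 * (of_nat m + a + d + 1) * (of_nat m + b + d + 1)"
  define k where "k = 2 * (c + of_nat i) + 1"
  have nz: "T \<noteq> 0" "U \<noteq> 0" "V \<noteq> 0" unfolding T_def U_def V_def using denominators_nonzero by simp_all
  have b: "\<beta> (2 * m) = 2 * a + 1 - Y / T - BI_C a b c d (2 * m)"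
    unfolding \<beta>_def A_even T_def Y_def ..
  have "X * T - (k + 2 * a + 1) * U * T + Y * U = - Z * D"
    unfolding T_def U_def D_def X_def Y_def Z_def k_def S_eq by algebra
  hence "X / U - (k + (2 * a + 1 - Y / T)) = - (Z / T) * (D / U)"
    using nz by (simp add: divide_simps) algebra
  hence "X / V * (V / U) - (k + (2 * a + 1 - Y / T - BI_C a b c d (2 * m))) - BI_C a b c d (2 * m) = - (Z / T) * (D / U)"
    using nz by (simp add: algebra_simps)
  thus ?thesis
    unfolding b G_def T_def U_def V_def D_def X_def Z_def k_def .
qed

text \<open>As in \<open>step_even_odd\<close>, U - D = T' clears the denominator, here that of
  \<open>C_even\<close>. Degree 1, where the ratio factors are absent, is left to
  \<open>step_zero_odd\<close>.\<close>

lemma step_odd_odd: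
  "- 2 * (c + d + of_nat i + 3/2) * ((of_nat i + 1) / (S + of_nat i + 1 + of_nat m))
   + (2 * (c + of_nat i) + 2 - \<beta> (2 * Suc m)) * ((of_nat i - of_nat m) / (S + 1 + of_nat i + of_nat m))
   - BI_C a b c d (2 * Suc m)
   = G (Suc m) * ((of_nat i - of_nat m) / (S + 1 + of_nat i + of_nat m))"
proof -
  define \<mu> :: complex where "\<mu> = of_nat (Suc m)"
  define T where "T = 2 * \<mu> + S"
  define T' where "T' = 2 * \<mu> + S - 1"
  define U where "U = S + 1 + of_nat i + of_nat m"
  define C where "C = BI_C a b c d (2 * Suc m)"
  define D :: complex where "D = of_nat i - of_nat m"
  define R where "R = 2 * (\<mu> + a + d + 1)"
  define X where "X = - 2 * (c + d + of_nat i + 3/2) * (of_nat i + 1)"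
  define k where "k = 2 * (c + of_nat i) + 2"
  have U': "S + of_nat i + 1 + of_nat m = U" by (simp add: U_def)
  have nz: "T \<noteq> 0" "T' \<noteq> 0" "U \<noteq> 0"
    unfolding T_def T'_def \<mu>_def U'[symmetric] using denominators_nonzero by blast+
  have CT: "C * T' = - (\<mu> * (2 * \<mu> + 2 * c + 2 * d + 1))"
    using nz unfolding C_def C_even T'_def \<mu>_def by simp
  have D: "U - D = T'" by (simp add: U_def D_def T'_def \<mu>_def)
  have "2 * (\<mu> + a + c + 1) * (\<mu> + a + d + 1) + R * (\<mu> + b + d + 1) = R * T"
    unfolding T_def R_def S_eq by algebra
  hence "2 * (\<mu> + a + c + 1) * (\<mu> + a + d + 1) / T + R * (\<mu> + b + d + 1) / T = R"
    using nz by (simp only: add_divide_distrib[symmetric]) simp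
  hence "\<beta> (2 * Suc m) + G (Suc m) = 2 * a + 1 - R - C"
    using nz unfolding \<beta>_def A_even G_def C_def \<mu>_def[symmetric] T_def[symmetric] R_def by (simp add: algebra_simps)
  moreover have "X + (k - 2 * a - 1 + R) * D - C * T' = 0"
    unfolding CT unfolding D_def X_def R_def k_def S_eq \<mu>_def by (simp add: field_simps)
  hence "X / U + (k - (2 * a + 1 - R - C)) * D / U = C"
    using nz D by (simp add: add_divide_distrib[symmetric] divide_eq_eq) algebra
  ultimately have "X / U + (k - (\<beta> (2 * Suc m) + G (Suc m))) * (D / U) = C" by simp
  moreover have "x + (k - (p + q)) * y = z \<longleftrightarrow> x + (k - p) * y - z = q * y" for p q x y z :: complex
    by (auto simp: algebra_simps)
  ultimately have "X / U + (k - \<beta> (2 * Suc m)) * (D / U) - C = G (Suc m) * (D / U)" by metis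
  moreover have "- 2 * (c + d + of_nat i + 3/2) * ((of_nat i + 1) / U) = X / U" by (simp add: X_def)
  ultimately show ?thesis
    unfolding U' unfolding U_def[symmetric] C_def[symmetric] D_def[symmetric] k_def[symmetric]
    by (simp only:)
qed

lemma step_zero_odd:
  "- 2 * (c + d + of_nat i + 3/2) + (2 * (c + of_nat i) + 2 - \<beta> 0) = G 0"
proof -
  have nz: "S \<noteq> 0" using denominators_nonzero(1)[of 0] by simp
  have b: "\<beta> 0 = 2 * a + 1 - 2 * (a + c + 1) * (a + d + 1) / S"
    using A_even[of 0] C_even[of 0] by (simp add: \<beta>_def)
  have "(- 2 * d - 2 * a - 2) * S + 2 * (a + c + 1) * (a + d + 1) = - (2 * (a + d + 1) * (b + d + 1))"
    unfolding S_eq by algebra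
  hence "- 2 * d - 2 * a - 2 + 2 * (a + c + 1) * (a + d + 1) / S = - (2 * (a + d + 1) * (b + d + 1) / S)"
    using nz by (simp add: divide_simps)
  thus ?thesis
    unfolding b G_def by (simp add: algebra_simps)
qed

end

section \<open>Moments of the weight\<close>

definition bi_kernel :: "complex \<Rightarrow> complex \<Rightarrow> complex \<Rightarrow> complex \<Rightarrow> complex \<Rightarrow> complex" where
  "bi_kernel p q r t s = gpair p s * gpair q s * (Gamma (r + s) * Gamma (r + 1 - s)) *
     (Gamma (t + s) * Gamma (t + 1 - s)) * sin (2 * of_real pi * s)"

definition bi_moment :: "complex \<Rightarrow> complex \<Rightarrow> complex \<Rightarrow> complex \<Rightarrow> complex poly \<Rightarrow> complex" where
  "bi_moment p q r t P = (LINT y|lborel. bi_kernel p q r t (Complex (1/4) y) * poly P (2 * Complex (1/4) y - 1/2))"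

lemma strip_decay_bi_kernel:
  assumes "Re p > a" "Re q > a" "Re r > a" "Re t > a"
  shows "strip_decay (- a) a 1 (\<lambda>s. bi_kernel p q r t s * poly P (2 * s - 1/2))"
proof -
  have "(7/5 :: real) < pi / 2" using pi_gt3 by simp
  hence "strip_decay (- a) a (14/5 + 14/5 + (7/5 + 7/5) + (7/5 + 7/5) + - (2 * pi) + - 1)
      (\<lambda>s. bi_kernel p q r t s * poly (P \<circ>\<^sub>p [:- 1/2, 2:]) s)"
    unfolding bi_kernel_def using assms
    by (intro strip_decay_mult strip_decay_gpair strip_decay_Gamma_plus strip_decay_Gamma_minus
          strip_decay_sin strip_decay_poly) auto
  moreover have "poly (P \<circ>\<^sub>p [:- 1/2, 2:]) s = poly P (2 * s - 1/2)" for s :: complex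
    by (simp add: poly_pcompose algebra_simps)
  ultimately have "strip_decay (- a) a (14/5 + 14/5 + (7/5 + 7/5) + (7/5 + 7/5) + - (2 * pi) + - 1)
      (\<lambda>s. bi_kernel p q r t s * poly P (2 * s - 1/2))"
    by simp
  thus ?thesis by (rule strip_decay_mono) (use pi_less_4 in simp)
qed

lemma ex_quarter_margin:
  fixes p q r t :: complex
  assumes "Re p > 1/4" "Re q > 1/4" "Re r > 1/4" "Re t > 1/4"
  obtains a where "a > 1/4" "Re p > a" "Re q > a" "Re r > a" "Re t > a"
proof -
  obtain a where "a > 0" "Re (p - 1/4) > a" "Re (q - 1/4) > a" "Re (r - 1/4) > a" "Re (t - 1/4) > a"
    by (rule ex_common_margin[of "p - 1/4" "q - 1/4" "r - 1/4" "t - 1/4"]) (use assms in auto)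
  thus ?thesis by (intro that[of "a + 1/4"]) auto
qed

locale bi_weight =
  fixes p q t :: complex
  assumes Re_gt: "Re p > 1/4" "Re q > 1/4" "Re t > 1/4"
begin

abbreviation "M \<equiv> \<lambda>r P. bi_moment p q r t P"

lemma integrable_bi_kernel:
  assumes "Re r > 1/4"
  shows "integrable lborel (\<lambda>y. bi_kernel p q r t (Complex (1/4) y) * poly P (2 * Complex (1/4) y - 1/2))"
proof -
  obtain a where "a > 1/4" "Re p > a" "Re q > a" "Re r > a" "Re t > a"
    using ex_quarter_margin[OF Re_gt(1,2) assms Re_gt(3)] .
  thus ?thesis by (intro strip_decay_integrable[OF strip_decay_bi_kernel[of a]]) auto
qed

lemma bi_moment_add: "Re r > 1/4 \<Longrightarrow> M r (P + Q) = M r P + M r Q"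
  unfolding bi_moment_def poly_add distrib_left
  by (intro Bochner_Integration.integral_add integrable_bi_kernel)

lemma bi_moment_smult: "M r (smult k P) = k * M r P"
  unfolding bi_moment_def poly_smult mult.left_commute[of _ k] by simp

lemma bi_moment_diff: "Re r > 1/4 \<Longrightarrow> M r (P - Q) = M r P - M r Q"
  using bi_moment_add[of r P "smult (- 1) Q"] bi_moment_smult[of r "- 1" Q] by simp

text \<open>In terms of \<open>x = 2 * s - 1/2\<close> the two linear factors are \<open>r + s\<close> and \<open>r + 1 - s\<close>.\<close>

lemma bi_moment_plus1:
  assumes "Re r > 1/4"
  shows "M r ([:r + 1/4, 1/2:] * [:r + 3/4, - 1/2:] * P) = M (r + 1) P"
  unfolding bi_moment_def
proof (intro Bochner_Integration.integral_cong refl)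
  fix y
  define s where "s = Complex (1/4) y"
  have "r + s \<notin> \<int>\<^sub>\<le>\<^sub>0" "r + 1 - s \<notin> \<int>\<^sub>\<le>\<^sub>0"
    using assms by (auto intro!: Re_pos_not_nonpos_Ints simp: s_def)
  from this[THEN Gamma_plus1] have "Gamma (r + 1 + s) = (r + s) * Gamma (r + s)"
    "Gamma (r + 1 + 1 - s) = (r + 1 - s) * Gamma (r + 1 - s)"
    by (simp_all add: algebra_simps)
  hence "bi_kernel p q (r + 1) t s = (r + s) * (r + 1 - s) * bi_kernel p q r t s"
    by (simp add: bi_kernel_def mult_ac)
  moreover have "poly [:r + 1/4, 1/2:] (2 * s - 1/2) = r + s" "poly [:r + 3/4, - 1/2:] (2 * s - 1/2) = r + 1 - s"
    by (simp_all add: field_simps)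
  ultimately show "bi_kernel p q r t (Complex (1/4) y) * poly ([:r + 1/4, 1/2:] * [:r + 3/4, - 1/2:] * P) (2 * Complex (1/4) y - 1/2)
    = bi_kernel p q (r + 1) t (Complex (1/4) y) * poly P (2 * Complex (1/4) y - 1/2)"
    unfolding s_def[symmetric] poly_mult by (metis mult.assoc mult.commute)
qed

text \<open>The odd part \<open>g\<close> of the integrand on the line \<open>Re s = 0\<close> integrates to zero.\<close>

lemma integral_shift_even_part:
  assumes r: "Re r > 1/4" and f: "\<And>s. Re s = 0 \<Longrightarrow>
      bi_kernel p q r t s * poly P (2 * s - 1/2) = g s - k * wilson_kernel p q r' t s"
    and odd: "\<And>s. g (- s) = - g s" and r': "Re r' > 0"
  shows "M r P = - k * wilson_integral p q r' t"
proof -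
  obtain a where a: "a > 1/4" "Re p > a" "Re q > a" "Re r > a" "Re t > a"
    using ex_quarter_margin[OF Re_gt(1,2) r Re_gt(3)] .
  note decay = strip_decay_bi_kernel[OF a(2-5), of P]
  have Re_pos: "Re p > 0" "Re q > 0" "Re t > 0" using Re_gt by auto
  have wilson: "integrable lborel (\<lambda>y. k * wilson_kernel p q r' t (Complex 0 y))"
    using integrable_wilson_kernel[OF Re_pos(1,2) r' Re_pos(3)] by simp
  have "integrable lborel (\<lambda>y. g (Complex 0 y) - k * wilson_kernel p q r' t (Complex 0 y))"
    using strip_decay_integrable[OF decay, of 0] a by (simp add: f)
  from Bochner_Integration.integrable_add[OF this wilson] have g: "integrable lborel (\<lambda>y. g (Complex 0 y))"
    by simp
  have "Complex 0 (- y) = - Complex 0 y" for y by (simp add: complex_eq_iff)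
  hence "(LINT y|lborel. g (Complex 0 y)) = - (LINT y|lborel. g (Complex 0 y))"
    using lborel_integral_uminus[of "\<lambda>y. g (Complex 0 y)"] by (simp add: odd)
  hence "(LINT y|lborel. g (Complex 0 y)) = 0" by simp
  moreover have "M r P = (LINT y|lborel. g (Complex 0 y) - k * wilson_kernel p q r' t (Complex 0 y))"
    unfolding bi_moment_def using strip_decay_shift[OF decay, of "1/4" 0] a by (simp add: f)
  ultimately show ?thesis
    using g wilson by (simp add: wilson_integral_def)
qed

text \<open>On the axis the kernel is (r - s)(t - s) times an odd function. The even part r t + s^2
  of this factor yields an odd integrand, and the odd part -(r + t) s yields Wilson's
  kernel.\<close>

lemma bi_moment_one:
  assumes r: "Re r > 1/4"
  shows "M r 1 = 2 * (of_real pi)\<^sup>2 * (r + t) * wilson_gammas p q r t / Gamma (p + q + r + t)"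
proof -
  have "M r 1 = - (r + t) * wilson_integral p q r t"
  proof (rule integral_shift_even_part[OF r])
    fix s :: complex assume s: "Re s = 0"
    have "r - s \<notin> \<int>\<^sub>\<le>\<^sub>0" "t - s \<notin> \<int>\<^sub>\<le>\<^sub>0"
      using Re_gt r s by (auto intro!: Re_pos_not_nonpos_Ints)
    from this[THEN Gamma_plus1] have *: "Gamma (r + 1 - s) = (r - s) * Gamma (r - s)"
      "Gamma (t + 1 - s) = (t - s) * Gamma (t - s)"
      by (simp_all add: algebra_simps)
    define Z where "Z = gpair p s * gpair q s * gpair r s * gpair t s * sin (2 * of_real pi * s)"
    have "bi_kernel p q r t s = (r - s) * (t - s) * Z" "wilson_kernel p q r t s = s * Z"
      by (simp_all only: bi_kernel_def wilson_kernel_def ssin_def gpair_def Z_def * mult_ac)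
    hence "bi_kernel p q r t s * poly 1 (2 * s - 1/2) = (r * t + s\<^sup>2) * Z - (r + t) * wilson_kernel p q r t s"
      by (simp add: algebra_simps power2_eq_square)
    thus "bi_kernel p q r t s * poly 1 (2 * s - 1/2)
        = (r * t + s\<^sup>2) * sin (2 * of_real pi * s) * (gpair p s * gpair q s * gpair r s * gpair t s)
          - (r + t) * wilson_kernel p q r t s"
      by (simp add: Z_def mult_ac)
  qed (use r in \<open>auto simp: gpair_def mult_ac\<close>)
  moreover have "Re p > 0" "Re q > 0" "Re r > 0" "Re t > 0" using Re_gt r by auto
  ultimately show ?thesis unfolding wilson_integral_eq[OF \<open>Re p > 0\<close> \<open>Re q > 0\<close> \<open>Re r > 0\<close> \<open>Re t > 0\<close>] by (simp add: minus_mult_left[symmetric] mult_ac del: minus_add_distrib)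
qed

text \<open>The factor r + s completes \<open>gpair (r + 1)\<close>, so only t - s is left to be
  split into its even and odd parts.\<close>

lemma bi_moment_linear:
  assumes r: "Re r > 1/4"
  shows "M r [:r + 1/4, 1/2:] = 2 * (of_real pi)\<^sup>2 * wilson_gammas p q (r + 1) t / Gamma (p + q + r + t + 1)"
proof -
  have "M r [:r + 1/4, 1/2:] = - 1 * wilson_integral p q (r + 1) t"
  proof (rule integral_shift_even_part[OF r])
    fix s :: complex assume s: "Re s = 0"
    have "r + s \<notin> \<int>\<^sub>\<le>\<^sub>0" "t - s \<notin> \<int>\<^sub>\<le>\<^sub>0"
      using Re_gt r s by (auto intro!: Re_pos_not_nonpos_Ints)
    from this[THEN Gamma_plus1] have *: "Gamma (r + 1 + s) = (r + s) * Gamma (r + s)"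
      "Gamma (t + 1 - s) = (t - s) * Gamma (t - s)"
      by (simp_all add: algebra_simps)
    have **: "poly [:r + 1/4, 1/2:] (2 * s - 1/2) = r + s" by (simp add: field_simps)
    define Z where "Z = gpair p s * gpair q s * gpair (r + 1) s * gpair t s * sin (2 * of_real pi * s)"
    have "(r + s) * bi_kernel p q r t s = (t - s) * Z" "wilson_kernel p q (r + 1) t s = s * Z"
      by (simp_all only: bi_kernel_def wilson_kernel_def ssin_def gpair_def Z_def * mult_ac)
    hence "bi_kernel p q r t s * poly [:r + 1/4, 1/2:] (2 * s - 1/2) = t * Z - 1 * wilson_kernel p q (r + 1) t s"
      unfolding ** by (simp add: algebra_simps)
    thus "bi_kernel p q r t s * poly [:r + 1/4, 1/2:] (2 * s - 1/2)
        = t * sin (2 * of_real pi * s) * (gpair p s * gpair q s * gpair (r + 1) s * gpair t s)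
          - 1 * wilson_kernel p q (r + 1) t s"
      by (simp add: Z_def mult_ac)
  qed (use r in \<open>auto simp: gpair_def mult_ac\<close>)
  moreover have "Re p > 0" "Re q > 0" "Re (r + 1) > 0" "Re t > 0" using Re_gt r by auto
  ultimately show ?thesis by (simp add: wilson_integral_eq add_ac)
qed

end

section \<open>Orthogonality\<close>

text \<open>Expanding x P_j P_n by the recurrence in either factor moves one degree from the first
  factor to the second. Induction on the smaller degree thus ends at P_0, where \<open>null\<close>
  applies; on the diagonal only the \<open>\<gamma>\<close> term survives.\<close>

lemma favard_orthogonality:
  fixes L :: "complex poly \<Rightarrow> complex" and P :: "nat \<Rightarrow> complex poly" and \<beta> \<gamma> :: "nat \<Rightarrow> complex"
  assumes add: "\<And>p q. L (p + q) = L p + L q" and smult: "\<And>k p. L (smult k p) = k * L p"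
    and P0: "P 0 = 1" and P1: "P (Suc 0) = [:- \<beta> 0, 1:]"
    and P_rec: "\<And>n. P (Suc (Suc n)) = [:- \<beta> (Suc n), 1:] * P (Suc n) - smult (\<gamma> (Suc n)) (P n)"
    and null: "\<And>n. L (P (Suc n)) = 0"
  shows "L (P n * P m) = L 1 * (if n = m then \<Prod>k=1..n. \<gamma> k else 0)"
proof -
  have diff: "L (p - q) = L p - L q" for p q
    using add[of p "smult (- 1) q"] smult[of "- 1" q] by simp
  have x: "[:- k, 1:] * p = monom 1 1 * p - smult k p" for k :: complex and p
    by (simp add: monom_Suc)
  \<comment> \<open>Degree 1 is separate from \<open>swap\<close>, since its recurrence has no
    \<open>\<gamma>\<close> term.\<close>
  have swap0: "L (P (Suc 0) * P (Suc n)) = L (P 0 * P (Suc (Suc n))) + (\<beta> (Suc n) - \<beta> 0) * L (P 0 * P (Suc n)) + \<gamma> (Suc n) * L (P 0 * P n)" for n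
  proof -
    have P1': "P (Suc 0) = monom 1 1 - smult (\<beta> 0) 1"
      using x[of "\<beta> 0" 1] P1 by simp
    show ?thesis
      unfolding P_rec[of n] x P1' P0 by (simp add: algebra_simps diff add smult del: One_nat_def)
  qed
  have swap: "L (P (Suc (Suc j)) * P (Suc n)) = L (P (Suc j) * P (Suc (Suc n))) + (\<beta> (Suc n) - \<beta> (Suc j)) * L (P (Suc j) * P (Suc n))
     + \<gamma> (Suc n) * L (P (Suc j) * P n) - \<gamma> (Suc j) * L (P j * P (Suc n))" for j n
    unfolding P_rec[of n] P_rec[of j] x by (simp add: algebra_simps diff add smult del: One_nat_def)
  have main: "L (P j * P j) = L 1 * (\<Prod>k=1..j. \<gamma> k) \<and> (\<forall>n>j. L (P j * P n) = 0)" for j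
  proof (induction j rule: less_induct)
    case (less j)
    consider "j = 0" | "j = Suc 0" | i where "j = Suc (Suc i)"
      by (metis not0_implies_Suc)
    thus ?case
    proof cases
      case 1
      thus ?thesis using null by (auto simp: P0 gr0_conv_Suc)
    next
      case 2
      have "L (P 0 * P n) = 0" if "n > 0" for n using less[of 0] 2 that by auto
      hence "L (P (Suc 0) * P (Suc n)) = L 1 * (if n = 0 then \<gamma> 1 else 0)" for n
        unfolding swap0 by (simp add: P0)
      thus ?thesis using 2 by (auto simp: gr0_conv_Suc Suc_less_eq2)
    next
      case 3
      have IH: "L (P i * P n) = 0" if "n > i" for n using less[of i] 3 that by auto
      have IH': "L (P (Suc i) * P n) = 0" if "n > Suc i" for n using less[of "Suc i"] 3 that by auto
      have "L (P (Suc i) * P (Suc i)) = L 1 * (\<Prod>k=1..Suc i. \<gamma> k)" using less[of "Suc i"] 3 by auto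
      hence "L (P (Suc (Suc i)) * P (Suc n)) = L 1 * (if n = Suc i then \<Prod>k=1..Suc (Suc i). \<gamma> k else 0)"
        if "n \<ge> Suc i" for n
        unfolding swap using that IH IH' by (auto simp: le_less)
      thus ?thesis using 3 by (auto simp: Suc_less_eq2)
    qed
  qed
  show ?thesis
    using main[of n] main[of m] by (cases n m rule: linorder_cases) (auto, metis mult.commute)
qed

section \<open>The functionals with shifted c and their values on the polynomials\<close>

locale bi_moments = bi_params +
  assumes Re_pos: "Re a > 0" "Re b > 0" "Re c > 0" "Re d > 0"

sublocale bi_moments \<subseteq> bi_weight "a + 3/4" "b + 3/4" "d + 1/4"
  using Re_pos by unfold_locales auto

context bi_moments
begin

definition L :: "nat \<Rightarrow> complex poly \<Rightarrow> complex" where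
  "L i P = M (c + of_nat i + 1/4) P"

text \<open>With r = c + i + 1/4 the linear polynomial is the factor r + s written in x.\<close>

definition L' :: "nat \<Rightarrow> complex poly \<Rightarrow> complex" where
  "L' i P = L i ([:c + of_nat i + 1/2, 1/2:] * P)"

text \<open>The part of the closed form that does not depend on \<open>i\<close>; its factors are
  those on the right-hand sides of the step lemmas.\<close>

definition coef :: "nat \<Rightarrow> complex" where
  "coef n = (\<Prod>k<n. if even k then G (k div 2) else BI_A a b c d k)"

lemma Re_shift: "Re (c + of_nat i + 1/4) > 1/4"
  using Re_pos by simp

lemma L_diff: "L i (P - Q) = L i P - L i Q"
  unfolding L_def by (rule bi_moment_diff[OF Re_shift])

lemma L_smult: "L i (smult k P) = k * L i P"
  unfolding L_def by (rule bi_moment_smult)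

lemma L'_diff: "L' i (P - Q) = L' i P - L' i Q"
  unfolding L'_def right_diff_distrib by (rule L_diff)

lemma L'_smult: "L' i (smult k P) = k * L' i P"
  unfolding L'_def mult_smult_right by (rule L_smult)

text \<open>This is x = 2 (r + s) - (2 (c + i) + 1).\<close>

lemma L_mult_linear: "L i ([:- k, 1:] * P) = 2 * L' i P - (2 * (c + of_nat i) + 1 + k) * L i P"
proof -
  have "[:- k, 1:] = smult 2 [:c + of_nat i + 1/2, 1/2:] - [:2 * (c + of_nat i) + 1 + k:]"
    by simp
  hence "[:- k, 1:] * P = smult 2 ([:c + of_nat i + 1/2, 1/2:] * P) - [:2 * (c + of_nat i) + 1 + k:] * P"
    by (simp only: left_diff_distrib mult_smult_left)
  also have "[:2 * (c + of_nat i) + 1 + k:] * P = smult (2 * (c + of_nat i) + 1 + k) P" by simp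
  finally have "[:- k, 1:] * P = smult 2 ([:c + of_nat i + 1/2, 1/2:] * P) - smult (2 * (c + of_nat i) + 1 + k) P" .
  thus ?thesis by (simp only: L_diff L_smult L'_def)
qed

text \<open>Here x = 2 (c + i) + 2 - 2 (r + 1 - s) is the useful form: together with the factor r +
  s already present, r + 1 - s raises \<open>c\<close> by one.\<close>

lemma L'_mult_linear: "L' i ([:- k, 1:] * P) = - 2 * L (Suc i) P + (2 * (c + of_nat i) + 2 - k) * L' i P"
proof -
  define l where "l = [:c + of_nat i + 1/2, 1/2:]"
  define l' where "l' = [:c + of_nat i + 1, - 1/2:]"
  have "[:- k, 1:] = smult (- 2) l' - smult (- (2 * (c + of_nat i) + 2 - k)) 1"
    by (simp add: l'_def)
  hence "l * ([:- k, 1:] * P) = smult (- 2) (l * l' * P) - smult (- (2 * (c + of_nat i) + 2 - k)) (l * P)"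
    by (simp only: left_diff_distrib right_diff_distrib mult_smult_left mult_smult_right mult_1 mult.assoc)
  moreover have "L i (l * l' * P) = L (Suc i) P"
    using bi_moment_plus1[OF Re_shift, of i P] unfolding L_def l_def l'_def by (simp add: add_ac)
  ultimately show ?thesis
    unfolding L'_def l_def[symmetric] by (simp only: L_diff L_smult minus_mult_left[symmetric] diff_minus_eq_add)
qed

lemma L_one: "L i 1 = 2 * (of_real pi)\<^sup>2 * BI_h0 a b (c + of_nat i) d"
proof -
  have "c + of_nat i + d + 1/2 \<notin> \<int>\<^sub>\<le>\<^sub>0" using Re_pos by (intro Re_pos_not_nonpos_Ints) simp
  from Gamma_plus1[OF this] have *: "Gamma (c + of_nat i + d + 3/2) = (c + of_nat i + d + 1/2) * Gamma (c + of_nat i + d + 1/2)"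
    by (simp add: add_ac)
  have "a + 3/4 + (b + 3/4) = a + b + 3/2" "a + 3/4 + (c + of_nat i + 1/4) = a + (c + of_nat i) + 1"
    "b + 3/4 + (c + of_nat i + 1/4) = b + (c + of_nat i) + 1" "a + 3/4 + (d + 1/4) = a + d + 1" "b + 3/4 + (d + 1/4) = b + d + 1"
    "c + of_nat i + 1/4 + (d + 1/4) = c + of_nat i + d + 1/2"
    "a + 3/4 + (b + 3/4) + (c + of_nat i + 1/4) + (d + 1/4) = a + b + (c + of_nat i) + d + 2"
    by simp_all
  thus ?thesis unfolding L_def bi_moment_one[OF Re_shift] wilson_gammas_def BI_h0_def * by (simp only:) (simp add: mult_ac)
qed

text \<open>Both moments are multiples of the same Wilson integral, with third parameter r + 1;
  their quotient is r + 1 + t.\<close>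

lemma L_Suc_one: "L (Suc i) 1 = (c + d + of_nat i + 3/2) * L' i 1"
proof -
  have r: "c + of_nat (Suc i) + 1/4 = c + of_nat i + 1/4 + 1" by simp
  have "c + of_nat i + 1/4 + 1 + (d + 1/4) = c + d + of_nat i + 3/2" by simp
  moreover have "L' i 1 = M (c + of_nat i + 1/4) [:c + of_nat i + 1/4 + 1/4, 1/2:]"
    by (simp add: L'_def L_def add.assoc)
  ultimately show ?thesis
    using bi_moment_one[OF Re_shift, of "Suc i"] bi_moment_linear[OF Re_shift, of i]
    unfolding L_def r by (simp add: add_ac)
qed

lemma h0_Suc: "(S + of_nat i) * BI_h0 a b (c + of_nat (Suc i)) d
  = (c + d + of_nat i + 3/2) * (a + c + of_nat i + 1) * (b + c + of_nat i + 1) * BI_h0 a b (c + of_nat i) d"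
proof -
  define e where "e = c + of_nat i"
  have e: "Re e > 0" using Re_pos by (simp add: e_def)
  have Gs: "Gamma (z + 1) = z * Gamma z" if "Re z > 0" for z :: complex
    using that by (intro Gamma_plus1 Re_pos_not_nonpos_Ints)
  have "Gamma (a + (e + 1) + 1) = (a + e + 1) * Gamma (a + e + 1)"
    "Gamma (b + (e + 1) + 1) = (b + e + 1) * Gamma (b + e + 1)"
    "Gamma (e + 1 + d + 3/2) = (e + d + 3/2) * Gamma (e + d + 3/2)"
    "Gamma (a + b + (e + 1) + d + 2) = (a + b + e + d + 2) * Gamma (a + b + e + d + 2)"
    using Gs[of "a + e + 1"] Gs[of "b + e + 1"] Gs[of "e + d + 3/2"] Gs[of "a + b + e + d + 2"] Re_pos e by (simp_all add: add_ac)
  moreover have "a + b + e + d + 2 \<noteq> 0" using Re_pos e by (auto simp: complex_eq_iff)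
  moreover have "c + of_nat (Suc i) = e + 1" "c + of_nat i = e" "S + of_nat i = a + b + e + d + 2"
    "c + d + of_nat i + 3/2 = e + d + 3/2" "a + c + of_nat i + 1 = a + e + 1" "b + c + of_nat i + 1 = b + e + 1"
    by (simp_all add: e_def S_eq)
  ultimately show ?thesis
    unfolding BI_h0_def by (simp only:) simp
qed

text \<open>\<open>L_Suc_one\<close> and \<open>h0_Suc\<close> both express
  \<open>L (Suc i) 1\<close>; the common factor c + d + i + 3/2 cancels.\<close>

lemma L'_one: "2 * L' i 1 = L i 1 * (2 * (a + c + of_nat i + 1) * (b + c + of_nat i + 1) / (S + of_nat i))"
proof -
  have "c + d + of_nat i + 3/2 \<noteq> 0" using Re_pos by (auto simp: complex_eq_iff)
  moreover have "S + of_nat i \<noteq> 0" by (rule denominators_nonzero)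
  moreover have "(S + of_nat i) * ((c + d + of_nat i + 3/2) * L' i 1)
    = (c + d + of_nat i + 3/2) * (a + c + of_nat i + 1) * (b + c + of_nat i + 1) * L i 1"
    using h0_Suc[of i] unfolding L_Suc_one[symmetric] L_one by algebra
  ultimately have "(S + of_nat i) * L' i 1 = (a + c + of_nat i + 1) * (b + c + of_nat i + 1) * L i 1"
    by (simp add: mult_ac)
  hence "2 * L' i 1 * (S + of_nat i) = L i 1 * (2 * (a + c + of_nat i + 1) * (b + c + of_nat i + 1))"
    by (simp only: mult_ac)
  with \<open>S + of_nat i \<noteq> 0\<close> show ?thesis
    by (simp only: eq_divide_eq times_divide_eq_right) simp
qed

lemma coef_Suc_even: "coef (Suc (2 * m)) = coef (2 * m) * G m"
  by (simp add: coef_def)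

lemma coef_Suc_odd: "coef (Suc (Suc (2 * m))) = coef (Suc (2 * m)) * BI_A a b c d (Suc (2 * m))"
  by (simp add: coef_def)

lemma bannai_ito_Suc_Suc:
  "bannai_ito a b c d (Suc (Suc n)) = [:- \<beta> (Suc n), 1:] * bannai_ito a b c d (Suc n)
     - smult (BI_A a b c d n * BI_C a b c d (Suc n)) (bannai_ito a b c d n)"
  by (simp add: \<beta>_def)

lemma L_bannai_ito_Suc_Suc:
  "L i (bannai_ito a b c d (Suc (Suc n))) = 2 * L' i (bannai_ito a b c d (Suc n))
     - (2 * (c + of_nat i) + 1 + \<beta> (Suc n)) * L i (bannai_ito a b c d (Suc n))
     - BI_A a b c d n * BI_C a b c d (Suc n) * L i (bannai_ito a b c d n)"
  unfolding bannai_ito_Suc_Suc L_diff L_mult_linear L_smult ..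

lemma L'_bannai_ito_Suc_Suc:
  "L' i (bannai_ito a b c d (Suc (Suc n))) = - 2 * L (Suc i) (bannai_ito a b c d (Suc n))
     + (2 * (c + of_nat i) + 2 - \<beta> (Suc n)) * L' i (bannai_ito a b c d (Suc n))
     - BI_A a b c d n * BI_C a b c d (Suc n) * L' i (bannai_ito a b c d n)"
  unfolding bannai_ito_Suc_Suc L'_diff L'_mult_linear L'_smult ..

text \<open>Degrees go in pairs because the coefficients alternate, and \<open>i\<close> is
  arbitrary because the recurrence for \<open>L'\<close> at \<open>i\<close> refers to
  \<open>L\<close> at \<open>Suc i\<close>.\<close>

lemma moments_bannai_ito:
  "L i (bannai_ito a b c d (2 * m)) = L i 1 * coef (2 * m) * falling_ratio S m i
   \<and> L' i (bannai_ito a b c d (2 * m)) = L' i 1 * coef (2 * m) * falling_ratio (S + 1) m i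
   \<and> L i (bannai_ito a b c d (Suc (2 * m))) = L i 1 * coef (Suc (2 * m)) * falling_ratio S (Suc m) i
   \<and> L' i (bannai_ito a b c d (Suc (2 * m))) = L' i 1 * coef (Suc (2 * m)) * falling_ratio (S + 1) m i"
proof (induction m arbitrary: i)
  case 0
  have B1: "bannai_ito a b c d (Suc 0) = [:- \<beta> 0, 1:] * 1" by (simp add: \<beta>_def)
  have C0: "BI_C a b c d 0 = 0" by (simp add: BI_C_def)
  have coef: "coef 0 = 1" "coef (Suc 0) = G 0" by (simp_all add: coef_def)
  have nz: "S + of_nat i \<noteq> 0" by (rule denominators_nonzero)
  have "L i (bannai_ito a b c d (Suc 0)) = L i 1 * (2 * (a + c + of_nat i + 1) * (b + c + of_nat i + 1) / (S + of_nat i)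
      - (2 * (c + of_nat i) + 1 + \<beta> 0))"
    unfolding B1 L_mult_linear L'_one by (simp only: right_diff_distrib mult.commute)
  also have "\<dots> = L i 1 * (G 0 * (of_nat i / (S + of_nat i)))"
    using step_odd_even[of i 0] C0 nz by simp
  finally have 1: "L i (bannai_ito a b c d (Suc 0)) = L i 1 * (G 0 * (of_nat i / (S + of_nat i)))" .
  have "L' i (bannai_ito a b c d (Suc 0)) = L' i 1 * (- 2 * (c + d + of_nat i + 3/2) + (2 * (c + of_nat i) + 2 - \<beta> 0))"
    unfolding B1 L'_mult_linear L_Suc_one by algebra
  hence 2: "L' i (bannai_ito a b c d (Suc 0)) = L' i 1 * G 0"
    unfolding step_zero_odd .
  show ?case
    using 1 2 by (simp add: coef falling_ratio_Suc)
next
  case (Suc m)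
  let ?B = "bannai_ito a b c d"
  have Re_S: "Re S > 0" using S_pos by simp
  define k where "k = coef (2 * m)"
  define A where "A = BI_A a b c d (Suc (2 * m))"
  define C where "C = BI_C a b c d (2 * Suc m)"
  define X where "X = (\<lambda>i. 2 * (a + c + of_nat i + 1) * (b + c + of_nat i + 1) / (S + of_nat i))"
  define Z where "Z = 2 * (of_nat m + a + c + 1) * (of_nat m + b + c + 1) / (2 * of_nat m + S)"
  define s where "s = (\<lambda>i. c + d + of_nat i + 3/2)"
  define w where "w = (\<lambda>i. (of_nat i + 1) / (S + of_nat i + 1 + of_nat m))"
  define g where "g = (\<lambda>i. (of_nat i - of_nat m) / (S + of_nat i + of_nat m))"
  define h where "h = (\<lambda>i. (of_nat i - of_nat m) / (S + 1 + of_nat i + of_nat m))"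
  define f where "f = falling_ratio S m"
  define f' where "f' = falling_ratio (S + 1) m"
  have fg: "falling_ratio S (Suc m) i = f i * g i" for i
    unfolding falling_ratio_Suc f_def g_def by simp
  have f'h: "falling_ratio (S + 1) (Suc m) i = f' i * h i" for i
    unfolding falling_ratio_Suc f'_def h_def by (simp add: add_ac)
  have f'w: "falling_ratio S (Suc m) (Suc i) = f' i * w i" for i
    unfolding falling_ratio_Suc_Suc f'_def w_def by simp
  have coefs: "coef (Suc (2 * m)) = k * G m" "coef (2 * Suc m) = k * G m * A"
      "coef (Suc (2 * Suc m)) = k * G m * A * G (Suc m)"
    using coef_Suc_even[of m] coef_Suc_even[of "Suc m"] coef_Suc_odd[of m] by (simp_all add: k_def A_def)
  have L'_one': "2 * L' i 1 = L i 1 * X i" for i unfolding X_def by (rule L'_one)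
  have L_Suc: "L (Suc i) 1 = s i * L' i 1" for i unfolding s_def by (rule L_Suc_one)
  have AC: "BI_A a b c d (2 * m) * BI_C a b c d (Suc (2 * m)) = G m * Z"
    unfolding AC_odd Z_def ..
  have AC': "BI_A a b c d (Suc (2 * m)) * BI_C a b c d (2 * Suc m) = A * C"
    unfolding A_def C_def ..
  have IH: "L i (?B (2 * m)) = L i 1 * k * f i"
    "L' i (?B (2 * m)) = L' i 1 * k * f' i"
    "L i (?B (Suc (2 * m))) = L i 1 * (k * G m) * (f i * g i)"
    "L' i (?B (Suc (2 * m))) = L' i 1 * (k * G m) * f' i" for i
    using Suc.IH[of i] by (simp_all only: coefs k_def f_def f'_def fg[unfolded f_def])
  \<comment> \<open>Rewritten to index \<open>i\<close>, this term shares the factors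
    \<open>L' i 1\<close> and \<open>f' i\<close> with the other terms of the recurrence for
    \<open>L'\<close>.\<close>
  have IH_Suc: "L (Suc i) (?B (Suc (2 * m))) = s i * L' i 1 * (k * G m) * (f' i * w i)" for i
    unfolding IH L_Suc fg[symmetric] f'w ..
  \<comment> \<open>Proved for every \<open>i\<close>, since the odd degree uses it at
    \<open>Suc i\<close> through \<open>even_Suc\<close>.\<close>
  have even: "L i (?B (2 * Suc m)) = L i 1 * (k * G m * A) * (f i * g i)"
    "L' i (?B (2 * Suc m)) = L' i 1 * (k * G m * A) * (f' i * h i)" for i
  proof -
    define v where "v = (S + of_nat i) / (S + of_nat i + of_nat m)"
    have f'v: "f' i = f i * v"
      unfolding f'_def f_def v_def by (simp add: falling_ratio_shift[OF Re_S])
    have index: "2 * Suc m = Suc (Suc (2 * m))" by simp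
    have step: "X i * v - (2 * (c + of_nat i) + 1 + \<beta> (Suc (2 * m))) * g i - Z = A * g i"
      unfolding X_def v_def g_def Z_def A_def by (rule step_even_even)
    have "L i (?B (2 * Suc m)) = 2 * L' i 1 * (k * G m) * f' i
        - (2 * (c + of_nat i) + 1 + \<beta> (Suc (2 * m))) * (L i 1 * (k * G m) * (f i * g i))
        - G m * Z * (L i 1 * k * f i)"
      unfolding index L_bannai_ito_Suc_Suc IH AC by (simp only: mult.assoc)
    also have "\<dots> = L i 1 * (k * G m) * f i * (X i * v - (2 * (c + of_nat i) + 1 + \<beta> (Suc (2 * m))) * g i - Z)"
      unfolding L'_one' f'v by algebra
    finally show "L i (?B (2 * Suc m)) = L i 1 * (k * G m * A) * (f i * g i)"
      unfolding step by (simp only: mult_ac)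
    have step: "- 2 * s i * w i + (2 * (c + of_nat i) + 2 - \<beta> (Suc (2 * m))) - Z = A * h i"
      unfolding s_def w_def Z_def A_def h_def by (rule step_even_odd)
    have "L' i (?B (2 * Suc m)) = - 2 * (s i * L' i 1 * (k * G m) * (f' i * w i))
        + (2 * (c + of_nat i) + 2 - \<beta> (Suc (2 * m))) * (L' i 1 * (k * G m) * f' i)
        - G m * Z * (L' i 1 * k * f' i)"
      unfolding index L'_bannai_ito_Suc_Suc IH_Suc IH(2,4) AC ..
    also have "\<dots> = L' i 1 * (k * G m) * f' i * (- 2 * s i * w i + (2 * (c + of_nat i) + 2 - \<beta> (Suc (2 * m))) - Z)"
      by algebra
    finally show "L' i (?B (2 * Suc m)) = L' i 1 * (k * G m * A) * (f' i * h i)"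
      unfolding step by (simp only: mult_ac)
  qed
  have even_Suc: "L (Suc i) (?B (2 * Suc m)) = s i * L' i 1 * (k * G m * A) * (f' i * w i)" for i
    unfolding even L_Suc fg[symmetric] f'w ..
  define g' where "g' = (of_nat i - of_nat (Suc m)) / (S + of_nat i + of_nat (Suc m))"
  define v where "v = (S + of_nat i) / (S + of_nat i + of_nat (Suc m))"
  have f'hv: "f' i * h i = f i * g i * v"
    unfolding f'h[symmetric] falling_ratio_shift[OF Re_S] fg v_def by simp
  have index: "Suc (2 * Suc m) = Suc (Suc (Suc (2 * m)))" "Suc (Suc (2 * m)) = 2 * Suc m" by simp_all
  have step: "X i * v - (2 * (c + of_nat i) + 1 + \<beta> (2 * Suc m)) - C = G (Suc m) * g'"
    unfolding X_def v_def C_def g'_def by (rule step_odd_even)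
  have "L i (?B (Suc (2 * Suc m))) = 2 * L' i 1 * (k * G m * A) * (f' i * h i)
      - (2 * (c + of_nat i) + 1 + \<beta> (2 * Suc m)) * (L i 1 * (k * G m * A) * (f i * g i))
      - A * C * (L i 1 * (k * G m) * (f i * g i))"
    unfolding index(1) L_bannai_ito_Suc_Suc[of i "Suc (2 * m)"] unfolding index(2) even AC' IH by (simp only: mult.assoc)
  also have "\<dots> = L i 1 * (k * G m * A) * (f i * g i) * (X i * v - (2 * (c + of_nat i) + 1 + \<beta> (2 * Suc m)) - C)"
    unfolding L'_one' f'hv by algebra
  finally have odd: "L i (?B (Suc (2 * Suc m))) = L i 1 * (k * G m * A * G (Suc m)) * (f i * g i * g')"
    unfolding step by (simp only: mult_ac)
  have step: "- 2 * s i * w i + (2 * (c + of_nat i) + 2 - \<beta> (2 * Suc m)) * h i - C = G (Suc m) * h i"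
    unfolding s_def w_def C_def h_def by (rule step_odd_odd)
  have "L' i (?B (Suc (2 * Suc m))) = - 2 * (s i * L' i 1 * (k * G m * A) * (f' i * w i))
      + (2 * (c + of_nat i) + 2 - \<beta> (2 * Suc m)) * (L' i 1 * (k * G m * A) * (f' i * h i))
      - A * C * (L' i 1 * (k * G m) * f' i)"
    unfolding index(1) L'_bannai_ito_Suc_Suc[of i "Suc (2 * m)"] unfolding index(2) even_Suc even(2) AC' IH(4) ..
  also have "\<dots> = L' i 1 * (k * G m * A) * f' i * (- 2 * s i * w i + (2 * (c + of_nat i) + 2 - \<beta> (2 * Suc m)) * h i - C)"
    by algebra
  finally have odd': "L' i (?B (Suc (2 * Suc m))) = L' i 1 * (k * G m * A * G (Suc m)) * (f' i * h i)"
    unfolding step by (simp only: mult_ac)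
  have fgg': "falling_ratio S (Suc (Suc m)) i = f i * g i * g'"
    unfolding falling_ratio_Suc[of S "Suc m"] fg g'_def by simp
  show ?case
    unfolding coefs fg fgg' f'h using even odd odd' by blast
qed

lemma falling_ratio_zero: "falling_ratio S (Suc m) 0 = 0"
  by (auto simp: falling_ratio_def)

lemma moment_bannai_ito_Suc: "L 0 (bannai_ito a b c d (Suc n)) = 0"
proof (cases "even (Suc n)")
  case True
  then obtain m where "Suc n = 2 * m" by blast
  moreover from this obtain m' where "m = Suc m'" by (cases m) auto
  ultimately show ?thesis
    using moments_bannai_ito[of 0 m] by (simp only: falling_ratio_zero) simp
next
  case False
  then obtain m where "Suc n = Suc (2 * m)" by (auto elim!: oddE)
  thus ?thesis
    using moments_bannai_ito[of 0 m] by (simp only: falling_ratio_zero) simp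
qed

lemma moment_orthogonality:
  "L 0 (bannai_ito a b c d n * bannai_ito a b c d m)
     = L 0 1 * (if n = m then \<Prod>k=1..n. BI_A a b c d (k - 1) * BI_C a b c d k else 0)"
proof (rule favard_orthogonality[where \<beta> = \<beta>])
  show "L 0 (P + Q) = L 0 P + L 0 Q" for P Q
    unfolding L_def by (rule bi_moment_add[OF Re_shift])
qed (auto simp: L_smult \<beta>_def moment_bannai_ito_Suc)

end

section \<open>The weight and the final substitution\<close>

lemma BI_W_pos:
  assumes "Re a > 0" "Re b > 0" "Re c > 0" "Re d > 0"
  shows "BI_W a b c d z > 0"
  using assms by (simp add: BI_W_def Gamma_nonzero_Re_pos)

text \<open>On Re s = 1/4 conjugation is s -> 1/2 - s. As c, d are the conjugates of a, b in some
  order, conjugating the Gamma factors of a, b gives the factors with r + 1 - s and t + 1 - s, and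
  conversely. The sine is pi / (Gamma(2s) Gamma(1 - 2s)).\<close>

lemma BI_W_eq_bi_kernel:
  assumes "(c, d) = (cnj a, cnj b) \<or> (c, d) = (cnj b, cnj a)"
  shows "of_real (BI_W a b c d (2 * y))
    = bi_kernel (a + 3/4) (b + 3/4) (c + 1/4) (d + 1/4) (Complex (1/4) y) / of_real pi"
proof -
  define s where "s = Complex (1/4) y"
  have iy: "\<i> * of_real (2 * y) = 2 * s - 1/2"
    by (simp add: s_def complex_eq_iff)
  have cnj_s: "cnj s = 1/2 - s" by (simp add: s_def complex_eq_iff)
  define w where "w = Gamma (a + 3/4 + s) * Gamma (b + 3/4 + s) * Gamma (c + 1/4 + s) * Gamma (d + 1/4 + s) / Gamma (2 * s)"
  have args: "x + (2 * s - 1/2) / 2 + 1 = x + 3/4 + s" "x + (2 * s - 1/2) / 2 + 1/2 = x + 1/4 + s" for x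
    by (simp_all add: field_simps)
  have "BI_W a b c d (2 * y) = (cmod w)\<^sup>2"
    unfolding BI_W_def iy args w_def by simp
  hence W: "of_real (BI_W a b c d (2 * y)) = w * cnj w"
    by (simp only: complex_norm_square)
  have cnj_args: "cnj (x + 3/4 + s) = cnj x + 1/4 + 1 - s" "cnj (x + 1/4 + s) = cnj x + 3/4 - s" "cnj (2 * s) = 1 - 2 * s" for x
    by (simp_all add: cnj_s)
  have "cnj w = Gamma (a + 3/4 - s) * Gamma (b + 3/4 - s) * Gamma (c + 1/4 + 1 - s) * Gamma (d + 1/4 + 1 - s) / Gamma (1 - 2 * s)"
    unfolding w_def complex_cnj_divide complex_cnj_mult cnj_Gamma cnj_args
    using assms by (auto simp: cnj_s mult_ac)
  hence "w * cnj w = gpair (a + 3/4) s * gpair (b + 3/4) s * (Gamma (c + 1/4 + s) * Gamma (c + 1/4 + 1 - s)) *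
      (Gamma (d + 1/4 + s) * Gamma (d + 1/4 + 1 - s)) / (Gamma (2 * s) * Gamma (1 - 2 * s))"
    by (simp only: w_def gpair_def times_divide_times_eq mult_ac)
  also have "\<dots> = bi_kernel (a + 3/4) (b + 3/4) (c + 1/4) (d + 1/4) s / of_real pi"
    unfolding Gamma_reflection_complex bi_kernel_def by (simp add: mult_ac)
  finally show ?thesis unfolding W s_def .
qed

text \<open>Integrability is asserted separately because the Bochner integral of a non-integrable
  function is 0 by convention.\<close>

theorem proposition3:
  fixes a b c d :: complex and n m :: nat
  assumes "Re a > 0" "Im a > 0" "Re b > 0" "Im b > 0"
    and "(c, d) = (cnj a, cnj b) \<or> (c, d) = (cnj b, cnj a)"
  shows "(\<forall>z. BI_W a b c d z > 0) \<and>
    integrable lborel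
      (\<lambda>z::real. of_real (BI_W a b c d z) * BI_Q a b c d n (of_real z) * BI_Q a b c d m (of_real z)) \<and>
    1 / (4 * of_real pi) *
      (LINT z|lborel. of_real (BI_W a b c d z) * BI_Q a b c d n (of_real z) * BI_Q a b c d m (of_real z))
      = BI_h0 a b c d * (if n = m then 1 else 0) * (\<Prod>k=1..n. BI_u a b c d k)"
proof -
  have Re_pos: "Re a > 0" "Re b > 0" "Re c > 0" "Re d > 0" using assms by auto
  interpret bi_moments a b c d "a + b + c + d + 2"
    using Re_pos by unfold_locales auto
  let ?B = "bannai_ito a b c d"
  define F where "F = (\<lambda>z::real. of_real (BI_W a b c d z) * BI_Q a b c d n (of_real z) * BI_Q a b c d m (of_real z))"
  define k where "k = (- \<i>) ^ n * (- \<i>) ^ m / of_real pi"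
  define I where "I = (\<lambda>y. bi_kernel (a + 3/4) (b + 3/4) (c + 1/4) (d + 1/4) (Complex (1/4) y)
    * poly (?B n * ?B m) (2 * Complex (1/4) y - 1/2))"
  \<comment> \<open>The form \<open>0 + 2 * y\<close> matches the affine substitution rule for
    \<open>lborel\<close>.\<close>
  have F: "F (0 + 2 * y) = k * I y" for y
  proof -
    have "\<i> * of_real (2 * y) = 2 * Complex (1/4) y - 1/2" by (simp add: complex_eq_iff)
    thus ?thesis
      unfolding F_def k_def I_def BI_Q_def poly_mult using BI_W_eq_bi_kernel[OF assms(5), of y] by simp
  qed
  have "integrable lborel I"
    unfolding I_def by (rule integrable_bi_kernel) (use Re_pos in simp)
  hence "integrable lborel (\<lambda>y. F (0 + 2 * y))" unfolding F by simp
  hence int: "integrable lborel F"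
    by (subst (asm) lborel_integrable_real_affine_iff) auto
  have "(LINT z|lborel. F z) = 2 * (k * (LINT y|lborel. I y))"
    using lborel_integral_real_affine[of 2 F 0] unfolding F by (simp add: scaleR_conv_of_real)
  also have "(LINT y|lborel. I y) = L 0 (?B n * ?B m)"
    by (simp add: L_def bi_moment_def I_def)
  also have "\<dots> = 2 * (of_real pi)\<^sup>2 * BI_h0 a b c d * (if n = m then \<Prod>k=1..n. BI_A a b c d (k - 1) * BI_C a b c d k else 0)"
    unfolding moment_orthogonality L_one by simp
  \<comment> \<open>The constants cancel: Jacobian 2, 1/pi from \<open>k\<close>, 2 pi^2 from
    \<open>L_one\<close>, and 1/(4 pi).\<close>
  finally have "1 / (4 * of_real pi) * (LINT z|lborel. F z)
      = BI_h0 a b c d * (if n = m then (- \<i>) ^ n * (- \<i>) ^ m * (\<Prod>k=1..n. BI_A a b c d (k - 1) * BI_C a b c d k) else 0)"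
    by (simp add: k_def power2_eq_square)
  also have "(if n = m then (- \<i>) ^ n * (- \<i>) ^ m * (\<Prod>k=1..n. BI_A a b c d (k - 1) * BI_C a b c d k) else 0)
      = (if n = m then 1 else 0) * (\<Prod>k=1..n. BI_u a b c d k)"
  proof (cases "n = m")
    case True
    \<comment> \<open>The resulting sign (-1)^n supplies one minus sign to each of the n factors
      \<open>BI_u\<close>.\<close>
    have "(- \<i>) ^ n * (- \<i>) ^ n = (\<Prod>k=1..n. - 1)"
      by (simp flip: power_mult_distrib)
    hence "(- \<i>) ^ n * (- \<i>) ^ n * (\<Prod>k=1..n. BI_A a b c d (k - 1) * BI_C a b c d k) = (\<Prod>k=1..n. BI_u a b c d k)"
      by (simp only: BI_u_def prod.distrib[symmetric]) simp
    thus ?thesis unfolding True[symmetric] by (simp only: simp_thms if_True mult_1)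
  qed simp
  finally show ?thesis
    using BI_W_pos[OF Re_pos] int unfolding F_def by (simp only: mult.assoc) simp
qed

end
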